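(* Let $H$ be a complex Hilbert space with $\dim H\ge 3$ and let $\varepsilon>0$. Suppose a surjective map $\Phi:\mathcal B(H)\to\mathcal B(H)$ satisfies $$\sigma_\varepsilon(\Phi(A)^*\Phi(B))=\sigma_\varepsilon(A^*B)\qquad\text{for all }A,B\in\mathcal B(H).$$ Then there exist $\alpha\in\mathbb C$ with $|\alpha|=1$ and unitary operators $U,V\in\mathcal B(H)$ such that $$\Phi(A)=\alpha UAV\quad\text{for every }A\in\mathcal B(H).$$
   Context: $\mathcal B(H)$ is the algebra of all bounded linear operators on $H$. For $\varepsilon>0$ and $A\in\mathcal B(H)$, the $\varepsilon$-pseudo spectrum is $\sigma_\varepsilon(A)=\{z\in\mathbb C:\|(zI-A)^{-1}\|>\varepsilon^{-1}\}$, with the usual convention $\|(zI-A)^{-1}\|=\infty$ when $z$ is in the spectrum of $A$. *)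

theory Defs
  imports "HOL-Analysis.Analysis"
begin

text \<open>
  The Banach structure is the underlying real one; the complex scalar multiplication extends
  \<open>scaleR\<close>.  The inner product is linear in its second argument and induces the norm.
\<close>

class complex_hilbert_space = banach +
  fixes scaleC :: "complex \<Rightarrow> 'a \<Rightarrow> 'a" (infixr "*\<^sub>C" 75)
    and cinner :: "'a \<Rightarrow> 'a \<Rightarrow> complex"
  assumes scaleC_add_right: "c *\<^sub>C (x + y) = c *\<^sub>C x + c *\<^sub>C y"
    and scaleC_add_left: "(c + d) *\<^sub>C x = c *\<^sub>C x + d *\<^sub>C x"
    and scaleC_scaleC: "c *\<^sub>C d *\<^sub>C x = (c * d) *\<^sub>C x"
    and scaleC_of_real: "complex_of_real r *\<^sub>C x = r *\<^sub>R x"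
    and cinner_commute: "cinner x y = cnj (cinner y x)"
    and cinner_add_right: "cinner x (y + z) = cinner x y + cinner x z"
    and cinner_scaleC_right: "cinner x (c *\<^sub>C y) = c * cinner x y"
    and cinner_self_nonneg: "0 \<le> Re (cinner x x)"
    and norm_eq_sqrt_cinner: "norm x = sqrt (Re (cinner x x))"

lemma scaleC_one: "1 *\<^sub>C x = (x :: 'a::complex_hilbert_space)"
  using scaleC_of_real[of 1 x] by simp

global_interpretation complex_vector:
  vector_space "scaleC :: complex \<Rightarrow> 'a \<Rightarrow> 'a::complex_hilbert_space"
  by standard (simp_all add: scaleC_add_right scaleC_add_left scaleC_scaleC scaleC_one)

lemma cinner_self: "cinner x x = complex_of_real ((norm x)\<^sup>2)"
  for x :: "'a::complex_hilbert_space"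
  using cinner_commute[of x x] cinner_self_nonneg[of x]
  by (simp add: norm_eq_sqrt_cinner complex_eq_iff)

lemma norm_scaleC: "norm (c *\<^sub>C x) = cmod c * norm x"
  for x :: "'a::complex_hilbert_space"
proof -
  have "cinner (c *\<^sub>C x) (c *\<^sub>C x) = c * cnj (cinner x (c *\<^sub>C x))"
    by (subst cinner_scaleC_right, subst cinner_commute) (rule refl)
  also have "\<dots> = (c * cnj c) * complex_of_real ((norm x)\<^sup>2)"
    by (simp add: cinner_scaleC_right cinner_self)
  also have "\<dots> = complex_of_real ((cmod c * norm x)\<^sup>2)"
    by (simp add: complex_norm_square [symmetric] power_mult_distrib)
  finally have "(norm (c *\<^sub>C x))\<^sup>2 = (cmod c * norm x)\<^sup>2"
    unfolding cinner_self of_real_eq_iff .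
  then show ?thesis by (simp add: power2_eq_iff_nonneg)
qed

lemma bounded_linear_scaleC: "bounded_linear (\<lambda>x. c *\<^sub>C (x :: 'a::complex_hilbert_space))"
proof (rule bounded_linear_intro)
  show "c *\<^sub>C (r *\<^sub>R x) = r *\<^sub>R (c *\<^sub>C x)" for r and x :: 'a
    by (simp flip: scaleC_of_real add: scaleC_scaleC mult.commute)
  show "norm (c *\<^sub>C x) \<le> norm x * cmod c" for x :: 'a
    by (simp add: norm_scaleC mult.commute)
qed (simp add: scaleC_add_right)

text \<open>
  The type \<open>'a \<Rightarrow>\<^sub>L 'a\<close> consists of the bounded real-linear operators, so the algebra of bounded
  complex-linear operators is a subset of it.  The operator norm is the same for both.
\<close>

definition bounded_operators :: "('a::complex_hilbert_space \<Rightarrow>\<^sub>L 'a) set" where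
  "bounded_operators = {A. \<forall>c x. blinfun_apply A (c *\<^sub>C x) = c *\<^sub>C blinfun_apply A x}"

lift_definition scaleC_op :: "complex \<Rightarrow> ('a::complex_hilbert_space \<Rightarrow>\<^sub>L 'a) \<Rightarrow> 'a \<Rightarrow>\<^sub>L 'a"
  is "\<lambda>c A x. c *\<^sub>C A x"
  by (rule bounded_linear_compose[OF bounded_linear_scaleC])

definition adjoint_op :: "('a::complex_hilbert_space \<Rightarrow>\<^sub>L 'a) \<Rightarrow> 'a \<Rightarrow>\<^sub>L 'a" where
  "adjoint_op A = (THE B. B \<in> bounded_operators \<and>
     (\<forall>x y. cinner (blinfun_apply A x) y = cinner x (blinfun_apply B y)))"

definition unitary_op :: "('a::complex_hilbert_space \<Rightarrow>\<^sub>L 'a) \<Rightarrow> bool" where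
  "unitary_op U \<longleftrightarrow> U \<in> bounded_operators \<and>
     adjoint_op U o\<^sub>L U = id_blinfun \<and> U o\<^sub>L adjoint_op U = id_blinfun"

definition is_inverse_op ::
    "('a::complex_hilbert_space \<Rightarrow>\<^sub>L 'a) \<Rightarrow> ('a \<Rightarrow>\<^sub>L 'a) \<Rightarrow> bool" where
  "is_inverse_op A B \<longleftrightarrow> B \<in> bounded_operators \<and> B o\<^sub>L A = id_blinfun \<and> A o\<^sub>L B = id_blinfun"

definition inverse_op :: "('a::complex_hilbert_space \<Rightarrow>\<^sub>L 'a) \<Rightarrow> 'a \<Rightarrow>\<^sub>L 'a" where
  "inverse_op A = (THE B. is_inverse_op A B)"

definition spectrum_op :: "('a::complex_hilbert_space \<Rightarrow>\<^sub>L 'a) \<Rightarrow> complex set" where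
  "spectrum_op A = {z. \<nexists>B. is_inverse_op (scaleC_op z id_blinfun - A) B}"

definition resolvent_norm :: "('a::complex_hilbert_space \<Rightarrow>\<^sub>L 'a) \<Rightarrow> complex \<Rightarrow> ereal" where
  "resolvent_norm A z =
     (if z \<in> spectrum_op A then \<infinity>
      else ereal (norm (inverse_op (scaleC_op z id_blinfun - A))))"

definition pseudo_spectrum ::
    "real \<Rightarrow> ('a::complex_hilbert_space \<Rightarrow>\<^sub>L 'a) \<Rightarrow> complex set" where
  "pseudo_spectrum \<epsilon> A = {z. resolvent_norm A z > ereal (inverse \<epsilon>)}"

end

theory Submission imports Defs begin

text \<open>
  The idea is to recover enough of \<open>\<Phi>\<close> from its values on the operators \<open>x y\<^sup>*\<close> of rank one, whose
  resolvents are explicit rational functions.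

  For \<open>T = x y\<^sup>*\<close> with trace \<open>a = \<langle>y, x\<rangle>\<close>, the norms of the resolvent at \<open>z\<close> and at \<open>a - z\<close> agree, because
  \<open>z - T\<close> and \<open>(z - a) + T\<close> are adjugate to each other on a plane.  The pseudospectrum of \<open>T\<close> is therefore a
  nonempty bounded set symmetric about \<open>a / 2\<close>, and such a set has only one centre.  So
  it determines the trace (\<open>trace_determined_by_pseudo_spectrum\<close>); and it also tells whether \<open>T = 0\<close>
  (\<open>rank1_zero_if_pseudo_spectrum_zero\<close>).

  An operator \<open>B\<close> has rank at most one if and only if no product \<open>A\<^sup>* B\<close> has as its pseudospectrum the union of
  the discs of radius \<open>\<epsilon>\<close> about \<open>0\<close>, \<open>4 \<epsilon>\<close> and \<open>8 \<epsilon>\<close> (\<open>rank1_iff_never_three_discs\<close>): an operator of higher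
  rank can be multiplied to a diagonal operator with these eigenvalues, where \<open>0\<close> occurs because the
  dimension is at least three, while a rank-one operator of trace \<open>8 \<epsilon>\<close> cannot
  produce exactly these discs.
  As \<open>\<Phi>\<close> is surjective, it preserves this property in both directions, so \<open>\<Phi> (x y\<^sup>*)\<close> is again of
  the form \<open>f g\<^sup>*\<close>.

  If \<open>\<Phi> (x y\<^sup>*) = f g\<^sup>*\<close>, equality of traces reads \<open>\<langle>\<Phi>(A) g, f\<rangle> = \<langle>A y, x\<rangle>\<close> for every \<open>A\<close> (\<open>trace_preserved\<close>).
  Preservation of vanishing products shows moreover that \<open>f\<close> and \<open>f'\<close> are orthogonal exactly when \<open>x\<close> and \<open>x'\<close>
  are.  Together these facts force the direction of \<open>f\<close> to depend on \<open>x\<close> only and that of \<open>g\<close> on \<open>y\<close> only,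
  and then \<open>f = U x\<close>, \<open>g = W y\<close> for unitary \<open>U\<close> and \<open>W\<close> after rescaling
  (\<open>image_rank1_unitary\<close>).  Inserting this into the trace identity yields \<open>\<Phi>(A) = U A W\<^sup>*\<close>.
\<close>

section \<open>Complex inner product spaces\<close>

lemma cinner_add_left: "cinner (x + y) z = cinner x z + cinner y z"
  for x :: "'a::complex_hilbert_space"
  by (metis cinner_add_right cinner_commute complex_cnj_add)

lemma cinner_scaleC_left: "cinner (c *\<^sub>C x) y = cnj c * cinner x y"
  for x :: "'a::complex_hilbert_space"
  by (metis cinner_commute cinner_scaleC_right complex_cnj_mult)

lemma cinner_scaleR_left: "cinner (r *\<^sub>R x) y = of_real r * cinner x y"
  for x :: "'a::complex_hilbert_space"
  by (metis cinner_scaleC_left complex_cnj_complex_of_real scaleC_of_real)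

lemma cinner_scaleR_right: "cinner x (r *\<^sub>R y) = of_real r * cinner x y"
  for x :: "'a::complex_hilbert_space"
  by (metis cinner_scaleC_right scaleC_of_real)

lemma cinner_zero_left [simp]: "cinner 0 x = 0"
  and cinner_zero_right [simp]: "cinner x 0 = 0"
  for x :: "'a::complex_hilbert_space"
  using cinner_scaleR_left[of 0 x x] cinner_scaleR_right[of x 0 x] by simp_all

lemma cinner_minus_left: "cinner (- x) y = - cinner x y"
  and cinner_minus_right: "cinner x (- y) = - cinner x y"
  for x :: "'a::complex_hilbert_space"
  using cinner_scaleR_left[of "-1" x y] cinner_scaleR_right[of x "-1" y] by simp_all

lemma cinner_diff_left: "cinner (x - y) z = cinner x z - cinner y z"
  and cinner_diff_right: "cinner z (x - y) = cinner z x - cinner z y"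
  for x :: "'a::complex_hilbert_space"
  by (simp_all add: diff_conv_add_uminus cinner_add_left cinner_add_right
      cinner_minus_left cinner_minus_right del: add_uminus_conv_diff)

lemmas cinner_simps = cinner_add_left cinner_add_right cinner_diff_left cinner_diff_right
  cinner_scaleC_left cinner_scaleC_right cinner_scaleR_left cinner_scaleR_right
  cinner_minus_left cinner_minus_right

lemma cinner_self_eq_0_iff [simp]: "cinner x x = 0 \<longleftrightarrow> x = 0"
  for x :: "'a::complex_hilbert_space"
  by (simp add: cinner_self)

lemma cinner_eq_0_commute: "cinner x y = 0 \<longleftrightarrow> cinner y x = 0"
  for x :: "'a::complex_hilbert_space"
  by (metis cinner_commute complex_cnj_zero)

lemma cinner_ext:
  assumes "\<And>z. cinner z x = cinner z y"
  shows "x = (y :: 'a::complex_hilbert_space)"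
proof -
  have "cinner (x - y) (x - y) = 0"
    using assms by (simp add: cinner_diff_right)
  then show ?thesis by simp
qed

lemma norm_add_sq: "(norm (x + y))\<^sup>2 = (norm x)\<^sup>2 + (norm y)\<^sup>2 + 2 * Re (cinner x y)"
  for x :: "'a::complex_hilbert_space"
proof -
  have "complex_of_real ((norm (x + y))\<^sup>2) = cinner (x + y) (x + y)"
    by (simp add: cinner_self)
  also have "\<dots> = cinner x x + cinner y y + (cinner x y + cnj (cinner x y))"
    by (simp add: cinner_simps flip: cinner_commute)
  also have "\<dots> = complex_of_real ((norm x)\<^sup>2 + (norm y)\<^sup>2 + 2 * Re (cinner x y))"
    by (simp only: complex_add_cnj cinner_self of_real_add)
  finally show ?thesis by (simp only: of_real_eq_iff)
qed

lemma norm_add_sq_orthogonal: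
  "cinner x y = 0 \<Longrightarrow> (norm (x + y))\<^sup>2 = (norm x)\<^sup>2 + (norm y)\<^sup>2"
  for x :: "'a::complex_hilbert_space"
  by (simp add: norm_add_sq)

lemma parallelogram_law:
  "(norm (x + y))\<^sup>2 + (norm (x - y))\<^sup>2 = 2 * (norm x)\<^sup>2 + 2 * (norm y)\<^sup>2"
  for x :: "'a::complex_hilbert_space"
  using norm_add_sq[of x y] norm_add_sq[of x "- y"] by (simp add: cinner_minus_right)

lemma orthogonal_part:
  fixes x y :: "'a::complex_hilbert_space"
  shows "cinner y (x - (cinner y x / cinner y y) *\<^sub>C y) = 0"
  by (cases "y = 0") (simp_all add: cinner_simps)

lemma cinner_Cauchy_Schwarz: "cmod (cinner x y) \<le> norm x * norm y"
  for x :: "'a::complex_hilbert_space"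
proof (cases "x = 0")
  case False
  let ?c = "cinner x y / cinner x x"
  let ?u = "y - ?c *\<^sub>C x"
  have "(norm (?c *\<^sub>C x + ?u))\<^sup>2 = (norm (?c *\<^sub>C x))\<^sup>2 + (norm ?u)\<^sup>2"
    using orthogonal_part[of x y]
    by (intro norm_add_sq_orthogonal) (simp add: cinner_scaleC_left)
  then have "(norm (?c *\<^sub>C x))\<^sup>2 \<le> (norm y)\<^sup>2" by simp
  then have "norm (?c *\<^sub>C x) \<le> norm y" by simp
  moreover have "norm (?c *\<^sub>C x) = cmod (cinner x y) / norm x"
    using False
    by (simp add: norm_scaleC norm_divide cinner_self power2_eq_square norm_mult)
  ultimately show ?thesis
    using False by (simp add: field_simps)
qed simp

lemma norm_eq_if_cinner_eq: "cinner x x = cinner y y \<Longrightarrow> norm x = norm y"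
  for x y :: "'a::complex_hilbert_space"
  by (simp add: norm_eq_sqrt_cinner)

lemma norm_normalized:
  fixes x :: "'a::complex_hilbert_space"
  assumes "x \<noteq> 0"
  shows "norm ((1 / complex_of_real (norm x)) *\<^sub>C x) = 1"
  using assms by (simp add: norm_scaleC norm_divide)

text \<open>Two vectors cannot span a space of dimension at least three.\<close>

lemma exists_orthogonal_to_two:
  fixes p q :: "'a::complex_hilbert_space"
  assumes dim: "\<exists>S :: 'a set. card S = 3 \<and> complex_vector.independent S"
  shows "\<exists>v. v \<noteq> 0 \<and> cinner p v = 0 \<and> cinner q v = 0"
proof -
  obtain S :: "'a set" where S: "card S = 3" "complex_vector.independent S"
    using dim by blast
  have fS: "finite S" using S(1) card.infinite by fastforce
  have "\<not> S \<subseteq> complex_vector.span {p, q}"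
  proof
    assume "S \<subseteq> complex_vector.span {p, q}"
    then have "card S \<le> card {p, q}"
      using complex_vector.independent_span_bound[of "{p,q}" S] S by simp
    also have "\<dots> \<le> 2" by (simp add: card_insert_le_m1)
    finally show False using S by simp
  qed
  then obtain s where s: "s \<notin> complex_vector.span {p, q}" by blast
  \<comment> \<open>Gram--Schmidt applied to \<open>p, q, s\<close>; division by zero makes the formulas valid when a vector vanishes too\<close>
  define q' where "q' = q - (cinner p q / cinner p p) *\<^sub>C p"
  define s' where "s' = s - (cinner p s / cinner p p) *\<^sub>C p"
  define v where "v = s' - (cinner q' s' / cinner q' q') *\<^sub>C q'"
  have pq': "cinner p q' = 0"
    unfolding q'_def by (rule orthogonal_part)
  have ps': "cinner p s' = 0"
    unfolding s'_def by (rule orthogonal_part)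
  have pv: "cinner p v = 0" by (simp add: v_def cinner_simps pq' ps')
  have q'v: "cinner q' v = 0"
    unfolding v_def by (rule orthogonal_part)
  have "q = q' + (cinner p q / cinner p p) *\<^sub>C p" by (simp add: q'_def)
  then have qv: "cinner q v = 0"
    by (metis (no_types, lifting) add.right_neutral cinner_add_left cinner_scaleC_left mult_zero_right pv q'v)
  have "v \<noteq> 0"
  proof
    assume "v = 0"
    then have "s = (cinner q' s' / cinner q' q') *\<^sub>C q' + (cinner p s / cinner p p) *\<^sub>C p"
      by (simp add: v_def s'_def algebra_simps)
    moreover have p: "p \<in> complex_vector.span {p, q}"
      by (simp add: complex_vector.span_base)
    moreover have "q' \<in> complex_vector.span {p, q}"
      unfolding q'_def
      by (intro complex_vector.span_diff complex_vector.span_scale p)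
        (simp add: complex_vector.span_base)
    ultimately have "s \<in> complex_vector.span {p, q}"
      by (metis complex_vector.span_add complex_vector.span_scale)
    then show False using s by blast
  qed
  then show ?thesis using pv qv by blast
qed

section \<open>The Riesz representation and adjoints\<close>

lemma zero_if_linear_le_quadratic:
  fixes a b :: real
  assumes "\<And>s. s > 0 \<Longrightarrow> 2 * s * a \<le> s\<^sup>2 * b" "a \<ge> 0"
  shows "a = 0"
proof (rule ccontr)
  assume "a \<noteq> 0"
  then have a: "a > 0" using assms by simp
  define s where "s = a / (\<bar>b\<bar> + 1)"
  have s: "s > 0" using a by (simp add: s_def)
  have "2 * a \<le> s * b"
    using assms(1)[OF s] s by (simp add: power2_eq_square)
  also have "\<dots> \<le> s * (\<bar>b\<bar> + 1)" using s by (intro mult_left_mono) auto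
  also have "\<dots> = a" by (simp add: s_def)
  finally show False using a by simp
qed


text \<open>
  The functional attains its norm on the unit sphere: by the parallelogram law, unit vectors on
  which \<open>f\<close> is real and nearly maximal lie close to each other, so a maximising sequence converges.  The
  representing vector is a multiple of the maximiser.
\<close>

lemma riesz_representation:
  fixes f :: "'a::complex_hilbert_space \<Rightarrow> complex"
  assumes f: "bounded_linear f" and fC: "\<And>c x. f (c *\<^sub>C x) = c * f x"
  shows "\<exists>y. \<forall>x. f x = cinner y x"
proof -
  interpret f: bounded_linear f by fact
  define N where "N = onorm f"
  have le: "cmod (f x) \<le> N * norm x" for x
    unfolding N_def by (rule onorm[OF f])
  show ?thesis
  proof (cases "N = 0")
    case True
    then have "f x = cinner 0 x" for x using le[of x] by simp
    then show ?thesis by blast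
  next
    case False
    then have N: "N > 0" unfolding N_def using onorm_pos_le[OF f] by simp
    have "\<exists>x. norm x = 1 \<and> Re (f x) \<ge> N * (1 - 1 / real (Suc n))" for n
    proof -
      have "\<exists>u. cmod (f u) > N * (1 - 1 / real (Suc n)) * norm u"
      proof (rule ccontr)
        assume "\<not> ?thesis"
        then have "\<forall>u. cmod (f u) \<le> N * (1 - 1 / real (Suc n)) * norm u"
          by (simp add: not_less)
        moreover have "N * (1 - 1 / real (Suc n)) \<ge> 0" using N by simp
        ultimately have "N \<le> N * (1 - 1 / real (Suc n))"
          unfolding N_def by (intro onorm_bound) auto
        then show False using N by (simp add: field_simps)
      qed
      then obtain u where u: "cmod (f u) > N * (1 - 1 / real (Suc n)) * norm u" by blast
      have "N * (1 - 1 / real (Suc n)) * norm u \<ge> 0" using N by simp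
      then have fu: "f u \<noteq> 0" using u by auto
      have u0: "u \<noteq> 0" using fu f.zero by auto
      \<comment> \<open>the scalar that normalises \<open>u\<close> and turns \<open>f u\<close> into a positive number\<close>
      define c where "c = cnj (f u) / complex_of_real (cmod (f u) * norm u)"
      have "norm (c *\<^sub>C u) = 1"
        using fu u0 by (simp add: c_def norm_scaleC norm_divide norm_mult)
      moreover have "f (c *\<^sub>C u) = complex_of_real (cmod (f u) / norm u)"
      proof -
        have "f (c *\<^sub>C u) = (f u * cnj (f u)) / complex_of_real (cmod (f u) * norm u)"
          by (simp add: fC c_def)
        also have "f u * cnj (f u) = complex_of_real ((cmod (f u))\<^sup>2)"
          by (rule complex_norm_square [symmetric])
        finally show ?thesis using fu by (simp add: power2_eq_square)
      qed
      moreover have "cmod (f u) / norm u \<ge> N * (1 - 1 / real (Suc n))"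
        using u u0 by (simp add: pos_le_divide_eq)
      ultimately show ?thesis
        by (intro exI[of _ "c *\<^sub>C u"]) simp
    qed
    then obtain X where X1: "\<And>n. norm (X n) = 1"
      and X2: "\<And>n. Re (f (X n)) \<ge> N * (1 - 1 / real (Suc n))"
      by metis
    have close: "(norm (X m - X n))\<^sup>2 \<le> 4 * (1 / real (Suc m) + 1 / real (Suc n))" for m n
    proof -
      let ?d = "1 / real (Suc m) + 1 / real (Suc n)"
      have "N * (2 - ?d) \<le> Re (f (X m + X n))"
        using X2[of m] X2[of n] by (simp add: f.add algebra_simps)
      also have "\<dots> \<le> N * norm (X m + X n)"
        using le[of "X m + X n"] complex_Re_le_cmod[of "f (X m + X n)"] by linarith
      finally have s: "2 - ?d \<le> norm (X m + X n)" using N by simp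
      have d: "0 \<le> 2 - ?d"
      proof -
        have "1 / real (Suc m) \<le> 1" "1 / real (Suc n) \<le> 1" by auto
        then show ?thesis by linarith
      qed
      have "(2 - ?d)\<^sup>2 \<le> (norm (X m + X n))\<^sup>2"
        using s d by (rule power_mono)
      moreover have "(2 - ?d)\<^sup>2 = 4 - 4 * ?d + ?d\<^sup>2"
        by (simp add: power2_eq_square algebra_simps)
      moreover have "?d\<^sup>2 \<ge> 0" by simp
      ultimately have "4 - 4 * ?d \<le> (norm (X m + X n))\<^sup>2" by linarith
      then show ?thesis
        using parallelogram_law[of "X m" "X n"] X1[of m] X1[of n] by simp
    qed
    have sum_small: "w < c" if "w \<le> 4 * (a + b)" "a < c / 8" "b < c / 8" for w a b c :: real
      using that by argo
    have "Cauchy X"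
    proof (rule metric_CauchyI)
      fix e :: real assume e: "e > 0"
      obtain M where M: "8 / e\<^sup>2 < real M" using reals_Archimedean2 by blast
      show "\<exists>M. \<forall>m\<ge>M. \<forall>n\<ge>M. dist (X m) (X n) < e"
      proof (intro exI allI impI)
        fix m n assume mn: "m \<ge> M" "n \<ge> M"
        have inv: "1 / real (Suc k) < e\<^sup>2 / 8" if "k \<ge> M" for k
        proof -
          have "8 / e\<^sup>2 < real (Suc k)" using M that by linarith
          then show ?thesis using e by (simp add: field_simps)
        qed
        have "(norm (X m - X n))\<^sup>2 < e\<^sup>2"
          by (rule sum_small[OF close[of m n] inv[OF mn(1)] inv[OF mn(2)]])
        then show "dist (X m) (X n) < e"
          using e by (simp add: dist_norm power_less_imp_less_base)
      qed
    qed
    then obtain x where x: "X \<longlonglongrightarrow> x"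
      using Cauchy_convergent_iff convergent_def by blast
    have nx: "norm x = 1"
      using tendsto_norm[OF x] X1 by (simp add: LIMSEQ_const_iff)
    have "(\<lambda>n. Re (f (X n))) \<longlonglongrightarrow> Re (f x)"
      by (intro tendsto_Re f.tendsto x)
    moreover have "(\<lambda>n. N * (1 - 1 / real (Suc n))) \<longlonglongrightarrow> N * (1 - 0)"
      by (intro tendsto_intros LIMSEQ_Suc[OF lim_1_over_n])
    ultimately have ReN: "N \<le> Re (f x)"
      using LIMSEQ_le X2 by fastforce
    have fx: "f x = complex_of_real N"
    proof -
      have c: "cmod (f x) \<le> N" using le[of x] nx by simp
      have "Re (f x) = N" using complex_Re_le_cmod[of "f x"] c ReN by linarith
      moreover have "Im (f x) = 0"
      proof -
        have "(cmod (f x))\<^sup>2 \<le> N\<^sup>2" using c by (rule power_mono) simp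
        then show ?thesis using calculation by (simp add: cmod_power2)
      qed
      ultimately show ?thesis by (simp add: complex_eq_iff)
    qed
    \<comment> \<open>\<open>f\<close> vanishes on the complement of the maximiser \<open>x\<close>: a step from \<open>x\<close> in an orthogonal
      direction changes the norm to second order only, but changes \<open>f\<close> to first order\<close>
    have orth: "f v = 0" if v: "cinner x v = 0" for v
    proof -
      have "2 * s * (cmod (f v))\<^sup>2 \<le> s\<^sup>2 * (N * (cmod (f v))\<^sup>2 * (norm v)\<^sup>2)" if s: "s > 0" for s
      proof -
        let ?a = "(cmod (f v))\<^sup>2"
        let ?u = "(of_real s * cnj (f v)) *\<^sub>C v"
        have "f (x + ?u) = complex_of_real (N + s * ?a)"
          using complex_norm_square[of "f v"] by (simp add: f.add fC fx mult.commute)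
        then have "cmod (f (x + ?u)) = N + s * ?a"
          using N s by (simp only: norm_of_real) simp
        then have "(N + s * ?a)\<^sup>2 \<le> (N * norm (x + ?u))\<^sup>2"
          using le[of "x + ?u"] N s by (intro power_mono) auto
        also have "\<dots> = N\<^sup>2 * (1 + s\<^sup>2 * ?a * (norm v)\<^sup>2)"
          by (subst power_mult_distrib, subst norm_add_sq_orthogonal)
            (simp_all add: cinner_simps v nx norm_scaleC norm_mult power_mult_distrib)
        finally have "2 * N * s * ?a + (s * ?a)\<^sup>2 \<le> N * (s\<^sup>2 * (N * ?a * (norm v)\<^sup>2))"
          by (simp add: power2_eq_square algebra_simps)
        then have "2 * N * s * ?a \<le> N * (s\<^sup>2 * (N * ?a * (norm v)\<^sup>2))"
          using zero_le_power2[of "s * ?a"] by linarith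
        then have "N * (2 * s * ?a) \<le> N * (s\<^sup>2 * (N * ?a * (norm v)\<^sup>2))"
          by (simp only: mult_ac)
        then show ?thesis using N by (simp only: mult_le_cancel_left_pos)
      qed
      then have "(cmod (f v))\<^sup>2 = 0" by (rule zero_if_linear_le_quadratic) simp_all
      then show ?thesis by simp
    qed
    have xx: "cinner x x = 1" by (simp add: cinner_self nx)
    have "f v = cinner (complex_of_real N *\<^sub>C x) v" for v
    proof -
      have "f (v - cinner x v *\<^sub>C x) = 0"
        using orthogonal_part[of x v] xx by (intro orth) simp
      then show ?thesis by (simp add: f.diff fC fx cinner_simps)
    qed
    then show ?thesis by blast
  qed
qed

lemma bounded_operatorsD:
  "A \<in> bounded_operators \<Longrightarrow> blinfun_apply A (c *\<^sub>C x) = c *\<^sub>C blinfun_apply A x"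
  by (simp add: bounded_operators_def)

lemma bounded_linear_cinner_right: "bounded_linear (\<lambda>x. cinner y x)"
  for y :: "'a::complex_hilbert_space"
proof (rule bounded_linear_intro[where K = "norm y"])
  show "cmod (cinner y x) \<le> norm x * norm y" for x
    using cinner_Cauchy_Schwarz[of y x] by (simp add: mult.commute)
qed (simp_all add: cinner_simps scaleR_conv_of_real)

lemma adjoint_exists:
  fixes A :: "'a::complex_hilbert_space \<Rightarrow>\<^sub>L 'a"
  assumes A: "A \<in> bounded_operators"
  shows "\<exists>B \<in> bounded_operators. \<forall>x y. cinner (blinfun_apply A x) y = cinner x (blinfun_apply B y)"
proof -
  have "\<exists>z. \<forall>x. cinner y (blinfun_apply A x) = cinner z x" for y
    using A by (intro riesz_representation)
      (auto intro: bounded_linear_compose[OF bounded_linear_cinner_right]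
        blinfun.bounded_linear_right simp: bounded_operatorsD cinner_simps)
  then obtain g where g: "\<And>y x. cinner y (blinfun_apply A x) = cinner (g y) x" by metis
  then have g': "\<And>y x. cinner (blinfun_apply A x) y = cinner x (g y)"
    by (metis cinner_commute)
  have "bounded_linear g"
  proof (rule bounded_linear_intro[where K = "norm A"])
    show "g (x + y) = g x + g y" for x y
      by (rule cinner_ext) (simp add: cinner_simps flip: g')
    show "g (r *\<^sub>R x) = r *\<^sub>R g x" for r x
      by (rule cinner_ext) (simp add: cinner_simps flip: g')
    show "norm (g y) \<le> norm y * norm A" for y
    proof (cases "g y = 0")
      case False
      have "(norm (g y))\<^sup>2 = cmod (cinner (g y) (g y))"
        by (simp only: cinner_self norm_of_real) simp
      also have "\<dots> = cmod (cinner y (blinfun_apply A (g y)))" by (simp only: g)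
      also have "\<dots> \<le> norm y * (norm A * norm (g y))"
        by (intro order_trans[OF cinner_Cauchy_Schwarz] mult_left_mono norm_blinfun) simp
      finally show ?thesis using False by (simp add: power2_eq_square)
    qed simp
  qed
  then have "blinfun_apply (Blinfun g) = g" by (rule bounded_linear_Blinfun_apply)
  moreover have "g (c *\<^sub>C x) = c *\<^sub>C g x" for c x
    by (rule cinner_ext) (simp add: cinner_simps flip: g')
  ultimately show ?thesis
    using g' by (intro bexI[of _ "Blinfun g"]) (auto simp: bounded_operators_def)
qed

lemma adjoint_op_eqI:
  fixes A :: "'a::complex_hilbert_space \<Rightarrow>\<^sub>L 'a"
  assumes "B \<in> bounded_operators"
    and "\<And>x y. cinner (blinfun_apply A x) y = cinner x (blinfun_apply B y)"
  shows "adjoint_op A = B"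
  unfolding adjoint_op_def
proof (rule the_equality)
  fix C assume C: "C \<in> bounded_operators \<and>
    (\<forall>x y. cinner (blinfun_apply A x) y = cinner x (blinfun_apply C y))"
  show "C = B"
    by (rule blinfun_eqI, rule cinner_ext) (metis C assms(2))
qed (use assms in blast)

lemma
  fixes A :: "'a::complex_hilbert_space \<Rightarrow>\<^sub>L 'a"
  assumes "A \<in> bounded_operators"
  shows adjoint_op_bounded: "adjoint_op A \<in> bounded_operators"
    and cinner_adjoint_op: "cinner x (blinfun_apply (adjoint_op A) y) = cinner (blinfun_apply A x) y"
proof -
  obtain B where "B \<in> bounded_operators"
    "\<forall>x y. cinner (blinfun_apply A x) y = cinner x (blinfun_apply B y)"
    using adjoint_exists[OF assms] by blast
  moreover from this have "adjoint_op A = B" by (intro adjoint_op_eqI) auto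
  ultimately show "adjoint_op A \<in> bounded_operators"
    "cinner x (blinfun_apply (adjoint_op A) y) = cinner (blinfun_apply A x) y" by auto
qed

lemma cinner_adjoint_op_left:
  fixes A :: "'a::complex_hilbert_space \<Rightarrow>\<^sub>L 'a"
  assumes "A \<in> bounded_operators"
  shows "cinner (blinfun_apply (adjoint_op A) y) x = cinner y (blinfun_apply A x)"
  by (metis assms cinner_adjoint_op cinner_commute)

section \<open>Rank-one operators\<close>

text \<open>
  The operator \<open>x y\<^sup>*\<close>, which has trace \<open>\<langle>y, x\<rangle>\<close> and norm \<open>\<parallel>x\<parallel> \<parallel>y\<parallel>\<close>.
\<close>

lift_definition rank1 :: "'a \<Rightarrow> 'a \<Rightarrow> 'a \<Rightarrow>\<^sub>L 'a::complex_hilbert_space"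
  is "\<lambda>x y v. cinner y v *\<^sub>C x"
proof (rule bounded_linear_intro)
  fix x y v w :: 'a and r :: real
  show "cinner y (v + w) *\<^sub>C x = cinner y v *\<^sub>C x + cinner y w *\<^sub>C x"
    by (simp add: cinner_simps scaleC_add_left)
  show "cinner y (r *\<^sub>R v) *\<^sub>C x = r *\<^sub>R cinner y v *\<^sub>C x"
    by (simp add: cinner_simps scaleC_scaleC flip: scaleC_of_real)
  show "norm (cinner y v *\<^sub>C x) \<le> norm v * (norm y * norm x)"
    using mult_right_mono[OF cinner_Cauchy_Schwarz[of y v] norm_ge_zero[of x]]
    by (simp add: norm_scaleC mult_ac)
qed

lemmas op_apply = rank1.rep_eq scaleC_op.rep_eq blinfun.add_left blinfun.diff_left
  blinfun.minus_left

lemma bounded_operators_scaleC_op [intro]: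
  "A \<in> bounded_operators \<Longrightarrow> scaleC_op c A \<in> bounded_operators"
  by (simp add: bounded_operators_def op_apply scaleC_scaleC mult.commute)

lemma bounded_operators_rank1 [intro]: "rank1 x y \<in> bounded_operators"
  by (simp add: bounded_operators_def op_apply cinner_simps scaleC_scaleC)

lemma bounded_operators_add [intro]:
  "A \<in> bounded_operators \<Longrightarrow> B \<in> bounded_operators \<Longrightarrow> A + B \<in> bounded_operators"
  by (simp add: bounded_operators_def op_apply scaleC_add_right)

lemma bounded_operators_id [intro]: "id_blinfun \<in> bounded_operators"
  by (simp add: bounded_operators_def)

lemma adjoint_rank1: "adjoint_op (rank1 x y) = rank1 y x"
  by (rule adjoint_op_eqI) (auto simp: op_apply cinner_simps simp flip: cinner_commute)

lemma compose_rank1: "A \<in> bounded_operators \<Longrightarrow> A o\<^sub>L rank1 x y = rank1 (blinfun_apply A x) y"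
  by (rule blinfun_eqI) (simp add: op_apply bounded_operatorsD)

lemma adjoint_compose_rank1:
  "adjoint_op (rank1 x y) o\<^sub>L rank1 x' y' = rank1 (cinner x x' *\<^sub>C y) y'"
  by (simp add: adjoint_rank1 compose_rank1 bounded_operators_rank1 op_apply)

section \<open>Pseudospectra of explicitly invertible operators\<close>

lemma is_inverse_op_unique:
  assumes "is_inverse_op A B" "is_inverse_op A C"
  shows "B = C"
proof (rule blinfun_eqI)
  fix v
  have "blinfun_apply B (blinfun_apply A (blinfun_apply C v)) = blinfun_apply C v"
    "blinfun_apply A (blinfun_apply C v) = v"
    using assms blinfun_apply_blinfun_compose[of B A "blinfun_apply C v"]
      blinfun_apply_blinfun_compose[of A C v]
    by (simp_all add: is_inverse_op_def)
  then show "blinfun_apply B v = blinfun_apply C v" by simp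
qed

text \<open>
  A form without case distinction: on the spectrum there is no \<open>R\<close>, and the right-hand side holds
  vacuously.
\<close>

lemma pseudo_spectrum_iff:
  "z \<in> pseudo_spectrum \<epsilon> A \<longleftrightarrow>
    (\<forall>R. is_inverse_op (scaleC_op z id_blinfun - A) R \<longrightarrow> norm R > inverse \<epsilon>)"
proof (cases "\<exists>R. is_inverse_op (scaleC_op z id_blinfun - A) R")
  case True
  then obtain R where R: "is_inverse_op (scaleC_op z id_blinfun - A) R" by blast
  then have "inverse_op (scaleC_op z id_blinfun - A) = R"
    unfolding inverse_op_def using is_inverse_op_unique by blast
  then have "z \<in> pseudo_spectrum \<epsilon> A \<longleftrightarrow> norm R > inverse \<epsilon>"
    using R by (auto simp: pseudo_spectrum_def resolvent_norm_def spectrum_op_def)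
  then show ?thesis
    using R is_inverse_op_unique[OF R] by blast
qed (auto simp: pseudo_spectrum_def resolvent_norm_def spectrum_op_def)

text \<open>
  A form without case distinction: on the spectrum there is no \<open>R\<close>, and the right-hand side holds
  vacuously.
\<close>

lemma pseudo_spectrum_iff_inverse:
  assumes "is_inverse_op (scaleC_op z id_blinfun - A) R"
  shows "z \<in> pseudo_spectrum \<epsilon> A \<longleftrightarrow> norm R > inverse \<epsilon>"
  using assms is_inverse_op_unique pseudo_spectrum_iff by blast

text \<open>
  On an eigenvector for \<open>c\<close>, an inverse of \<open>z - A\<close> acts as multiplication by \<open>1 / (z - c)\<close>.
\<close>

lemma near_eigenvalue_in_pseudo_spectrum:
  assumes v: "blinfun_apply A v = c *\<^sub>C v" "v \<noteq> 0" and near: "cmod (z - c) < \<epsilon>"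
  shows "z \<in> pseudo_spectrum \<epsilon> A"
  unfolding pseudo_spectrum_iff
proof (intro allI impI)
  fix R assume R: "is_inverse_op (scaleC_op z id_blinfun - A) R"
  have "blinfun_apply R (blinfun_apply (scaleC_op z id_blinfun - A) v) = v"
    using R blinfun_apply_blinfun_compose[of R "scaleC_op z id_blinfun - A" v]
    by (simp add: is_inverse_op_def)
  then have "blinfun_apply R ((z - c) *\<^sub>C v) = v"
    by (simp add: op_apply v complex_vector.scale_left_diff_distrib)
  then have "norm v \<le> norm R * (cmod (z - c) * norm v)"
    by (metis norm_blinfun norm_scaleC)
  then have 1: "1 \<le> norm R * cmod (z - c)" using v(2) by simp
  then have "norm R \<noteq> 0" by auto
  then have "1 < norm R * \<epsilon>"
    using 1 near by (smt (verit) mult_strict_left_mono norm_ge_zero)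
  moreover have "\<epsilon> > 0" using near norm_ge_zero[of "z - c"] by linarith
  ultimately show "inverse \<epsilon> < norm R" by (simp add: field_simps)
qed

lemma norm_blinfun_bound_unit:
  fixes A :: "'a::complex_hilbert_space \<Rightarrow>\<^sub>L 'a"
  assumes "b \<ge> 0" "\<And>v. norm v = 1 \<Longrightarrow> norm (blinfun_apply A v) \<le> b"
  shows "norm A \<le> b"
proof (rule norm_blinfun_bound)
  fix v
  show "norm (blinfun_apply A v) \<le> b * norm v"
  proof (cases "v = 0")
    case False
    then have "norm (blinfun_apply A ((1 / norm v) *\<^sub>R v)) \<le> b"
      by (intro assms(2)) simp
    then show ?thesis using False by (simp add: blinfun.scaleR_right field_simps)
  qed simp
qed (rule assms)

lemma norm_scaleC_op: "norm (scaleC_op c A) = cmod c * norm A"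
proof -
  have le: "norm (scaleC_op c A) \<le> cmod c * norm A" for c and A :: "'a \<Rightarrow>\<^sub>L 'a"
    by (rule norm_blinfun_bound)
      (simp_all add: op_apply norm_scaleC mult.assoc mult_left_mono norm_blinfun)
  show ?thesis
  proof (cases "c = 0")
    case True
    then show ?thesis using le[of c A] by simp
  next
    case False
    have "scaleC_op (1 / c) (scaleC_op c A) = A"
      using False by (intro blinfun_eqI) (simp add: op_apply scaleC_scaleC scaleC_one)
    then have "norm A \<le> cmod (1 / c) * norm (scaleC_op c A)" using le by metis
    then show ?thesis using le[of c A] False by (simp add: norm_divide field_simps)
  qed
qed

lemma norm_rank1_le: "norm (rank1 x y) \<le> norm x * norm y"
proof (rule norm_blinfun_bound)
  fix v
  show "norm (blinfun_apply (rank1 x y) v) \<le> norm x * norm y * norm v"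
    using mult_left_mono[OF cinner_Cauchy_Schwarz[of y v] norm_ge_zero[of x]]
    by (simp add: op_apply norm_scaleC mult_ac)
qed simp

lemma norm_id_blinfun_le: "norm (id_blinfun :: 'a::complex_hilbert_space \<Rightarrow>\<^sub>L 'a) \<le> 1"
  by (rule norm_blinfun_bound) simp_all

lemma norm_scaleC_id_add_le:
  fixes A :: "'a::complex_hilbert_space \<Rightarrow>\<^sub>L 'a"
  shows "norm (scaleC_op z id_blinfun + A) \<le> cmod z + norm A"
proof -
  have "cmod z * norm (id_blinfun :: 'a \<Rightarrow>\<^sub>L 'a) \<le> cmod z * 1"
    by (intro mult_left_mono norm_id_blinfun_le) simp
  then show ?thesis
    using norm_triangle_ineq[of "scaleC_op z id_blinfun" A] by (simp add: norm_scaleC_op)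
qed

section \<open>Pseudospectra of rank-one operators\<close>

text \<open>
  With \<open>T = x y\<^sup>*\<close> and \<open>a = \<langle>y, x\<rangle>\<close> one has \<open>T\<^sup>2 = a T\<close>, whence
  \<open>(z - T) ((z - a) + T) = z (z - a)\<close>.
\<close>

lemma rank1_resolvent:
  assumes "z \<noteq> 0" "z \<noteq> cinner y x"
  shows "is_inverse_op (scaleC_op z id_blinfun - rank1 x y)
    (scaleC_op (1 / (z * (z - cinner y x)))
      (scaleC_op (z - cinner y x) id_blinfun + rank1 x y))"
proof -
  let ?S = "scaleC_op z id_blinfun - rank1 x y"
  define k where "k = 1 / (z * (z - cinner y x))"
  define R where "R = scaleC_op k (scaleC_op (z - cinner y x) id_blinfun + rank1 x y)"
  have k: "k * (z * (z - cinner y x)) = 1" using assms by (simp add: k_def)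
  have "R \<in> bounded_operators" unfolding R_def by blast
  moreover have "R o\<^sub>L ?S = id_blinfun"
  proof (intro blinfun_eqI cinner_ext)
    fix v u
    have "cinner u (blinfun_apply (R o\<^sub>L ?S) v) = (k * (z * (z - cinner y x))) * cinner u v"
      by (simp add: R_def op_apply cinner_simps algebra_simps)
    then show "cinner u (blinfun_apply (R o\<^sub>L ?S) v) = cinner u (blinfun_apply id_blinfun v)"
      by (simp add: k)
  qed
  moreover have "?S o\<^sub>L R = id_blinfun"
  proof (intro blinfun_eqI cinner_ext)
    fix v u
    have "cinner u (blinfun_apply (?S o\<^sub>L R) v) = (k * (z * (z - cinner y x))) * cinner u v"
      by (simp add: R_def op_apply cinner_simps algebra_simps)
    then show "cinner u (blinfun_apply (?S o\<^sub>L R) v) = cinner u (blinfun_apply id_blinfun v)"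
      by (simp add: k)
  qed
  ultimately show ?thesis by (simp add: is_inverse_op_def R_def k_def)
qed

lemma rank1_pseudo_spectrum_iff:
  assumes "z \<noteq> 0" "z \<noteq> cinner y x"
  shows "z \<in> pseudo_spectrum \<epsilon> (rank1 x y) \<longleftrightarrow>
    norm (scaleC_op (z - cinner y x) id_blinfun + rank1 x y) / (cmod z * cmod (z - cinner y x))
      > inverse \<epsilon>"
  using pseudo_spectrum_iff_inverse[OF rank1_resolvent[OF assms]]
  by (simp add: norm_scaleC_op norm_divide norm_mult)

lemma decompose_along_unit:
  fixes v x :: "'a::complex_hilbert_space"
  assumes dim: "\<exists>S :: 'a set. card S = 3 \<and> complex_vector.independent S"
    and v: "norm v = 1"
  obtains w \<alpha> \<beta> where "norm w = 1" "cinner v w = 0" "x = \<alpha> *\<^sub>C v + \<beta> *\<^sub>C w"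
proof -
  define r where "r = x - (cinner v x / cinner v v) *\<^sub>C v"
  have vr: "cinner v r = 0" unfolding r_def by (rule orthogonal_part)
  have x: "x = (cinner v x / cinner v v) *\<^sub>C v + r" by (simp add: r_def)
  show ?thesis
  proof (cases "r = 0")
    case True
    obtain w where w: "w \<noteq> 0" "cinner v w = 0"
      using exists_orthogonal_to_two[OF dim] by blast
    show ?thesis
      by (rule that[of "(1 / complex_of_real (norm w)) *\<^sub>C w" "cinner v x / cinner v v" 0])
        (use w x True in \<open>simp_all add: norm_normalized cinner_simps\<close>)
  next
    case False
    show ?thesis
      by (rule that[of "(1 / complex_of_real (norm r)) *\<^sub>C r" "cinner v x / cinner v v"
            "complex_of_real (norm r)"])
        (use False x vr in \<open>simp_all add: norm_normalized cinner_simps scaleC_scaleC scaleC_one\<close>)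
  qed
qed

lemma norm_orthonormal_combination:
  fixes v w :: "'a::complex_hilbert_space"
  assumes "norm v = 1" "norm w = 1" "cinner v w = 0"
  shows "(norm (A *\<^sub>C v + B *\<^sub>C w))\<^sup>2 = (cmod A)\<^sup>2 + (cmod B)\<^sup>2"
  using assms by (simp add: norm_add_sq_orthogonal cinner_simps norm_scaleC)

text \<open>
  On a plane containing \<open>x\<close> and \<open>y\<close>, \<open>(z - a) + T\<close> is the adjugate of \<open>z - T\<close>, and a
  \<open>2 \<times> 2\<close> matrix has the same norm as its adjugate.  The proof carries this out vector by vector:
  for a unit vector \<open>v\<close>, the vector \<open>x\<close> lies in the plane of \<open>v\<close> and some unit vector
  \<open>w\<close> orthogonal to \<open>v\<close>, and \<open>w\<close> is stretched by the adjoint of the adjugate at least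
  as much as \<open>v\<close> is by \<open>z - T\<close>.
\<close>

lemma rank1_adjugate_norm_le:
  fixes x y :: "'a::complex_hilbert_space"
  assumes dim: "\<exists>S :: 'a set. card S = 3 \<and> complex_vector.independent S"
  shows "norm (scaleC_op z id_blinfun - rank1 x y)
    \<le> norm (scaleC_op (z - cinner y x) id_blinfun + rank1 x y)" (is "norm ?S \<le> norm ?S'")
proof (rule norm_blinfun_bound_unit)
  fix v :: 'a assume v: "norm v = 1"
  obtain w \<alpha> \<beta> where w: "norm w = 1" and vw: "cinner v w = 0"
    and x: "x = \<alpha> *\<^sub>C v + \<beta> *\<^sub>C w"
    using decompose_along_unit[OF dim v] by blast
  have wv: "cinner w v = 0" using vw by (simp add: cinner_eq_0_commute)
  have vv: "cinner v v = 1" and ww: "cinner w w = 1" using v w by (simp_all add: cinner_self)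
  define g where "g = cinner y v"
  define A where "A = z - g * \<alpha>"
  define B where "B = g * \<beta>"
  \<comment> \<open>\<open>m\<close> is the component in the plane of \<open>v\<close> and \<open>w\<close> of the adjoint of \<open>(z - a) + T\<close> applied to \<open>w\<close>;
    its coordinates are those of \<open>(z - T) v\<close>, up to conjugation, sign and order\<close>
  define m where "m = cnj B *\<^sub>C v + cnj A *\<^sub>C w"
  have Sv: "blinfun_apply ?S v = A *\<^sub>C v + (- B) *\<^sub>C w"
    by (rule cinner_ext) (simp add: op_apply cinner_simps x A_def B_def g_def algebra_simps)
  have m_norm: "norm m = norm (blinfun_apply ?S v)"
  proof -
    have "(norm m)\<^sup>2 = (norm (blinfun_apply ?S v))\<^sup>2"
      unfolding m_def Sv norm_orthonormal_combination[OF v w vw] by simp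
    then show ?thesis by simp
  qed
  have "cinner w (blinfun_apply ?S' m) = A * cnj A + B * cnj B"
    by (simp add: op_apply cinner_simps m_def x wv ww A_def B_def g_def algebra_simps)
  also have "\<dots> = complex_of_real ((cmod A)\<^sup>2 + (cmod B)\<^sup>2)"
    by (simp add: complex_norm_square del: of_real_power)
  also have "\<dots> = complex_of_real ((norm (blinfun_apply ?S v))\<^sup>2)"
    unfolding Sv norm_orthonormal_combination[OF v w vw] by simp
  finally have "(norm (blinfun_apply ?S v))\<^sup>2 = cmod (cinner w (blinfun_apply ?S' m))"
    by (simp only: norm_of_real) simp
  also have "\<dots> \<le> norm w * (norm ?S' * norm m)"
    by (intro order_trans[OF cinner_Cauchy_Schwarz] mult_left_mono norm_blinfun) simp
  finally have "norm (blinfun_apply ?S v) * norm (blinfun_apply ?S v)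
      \<le> norm ?S' * norm (blinfun_apply ?S v)"
    by (simp add: w m_norm power2_eq_square)
  then show "norm (blinfun_apply ?S v) \<le> norm ?S'"
    by (cases "norm (blinfun_apply ?S v) = 0") auto
qed simp

lemma rank1_spectrum_in_pseudo_spectrum:
  fixes x y :: "'a::complex_hilbert_space"
  assumes dim: "\<exists>S :: 'a set. card S = 3 \<and> complex_vector.independent S"
    and eps: "\<epsilon> > 0" and z: "z = 0 \<or> z = cinner y x"
  shows "z \<in> pseudo_spectrum \<epsilon> (rank1 x y)"
proof -
  obtain v where v: "v \<noteq> 0" "cinner y v = 0"
    using exists_orthogonal_to_two[OF dim] by blast
  have 0: "0 \<in> pseudo_spectrum \<epsilon> (rank1 x y)"
    by (rule near_eigenvalue_in_pseudo_spectrum[of _ v 0]) (use v eps in \<open>simp_all add: op_apply\<close>)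
  have "cinner y x \<in> pseudo_spectrum \<epsilon> (rank1 x y)" if "x \<noteq> 0"
    by (rule near_eigenvalue_in_pseudo_spectrum[of _ x "cinner y x"])
      (use that eps in \<open>simp_all add: op_apply\<close>)
  then show ?thesis using 0 z by (cases "x = 0") auto
qed

text \<open>
  The adjugate of \<open>z - T\<close> is \<open>-((a - z) - T)\<close>, and both operators have determinant \<open>z (z - a)\<close> on
  a plane containing \<open>x\<close> and \<open>y\<close>.  So the resolvents at \<open>z\<close> and at \<open>a - z\<close> have the same norm.
\<close>

lemma rank1_pseudo_spectrum_symmetric:
  fixes x y :: "'a::complex_hilbert_space"
  assumes dim: "\<exists>S :: 'a set. card S = 3 \<and> complex_vector.independent S"
    and eps: "\<epsilon> > 0" and z: "z \<in> pseudo_spectrum \<epsilon> (rank1 x y)"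
  shows "cinner y x - z \<in> pseudo_spectrum \<epsilon> (rank1 x y)"
proof (cases "z = 0 \<or> z = cinner y x")
  case True
  then show ?thesis by (intro rank1_spectrum_in_pseudo_spectrum dim eps) auto
next
  case False
  let ?a = "cinner y x"
  have eq: "scaleC_op (?a - z - ?a) id_blinfun + rank1 x y = - (scaleC_op z id_blinfun - rank1 x y)"
    "scaleC_op (z - ?a) id_blinfun + rank1 x y = - (scaleC_op (?a - z) id_blinfun - rank1 x y)"
    by (rule blinfun_eqI, rule cinner_ext, simp add: op_apply cinner_simps algebra_simps)+
  have "norm (scaleC_op (z - ?a) id_blinfun + rank1 x y)
    \<le> norm (scaleC_op (?a - z - ?a) id_blinfun + rank1 x y)"
    unfolding eq(2) norm_minus_cancel by (rule rank1_adjugate_norm_le[OF dim])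
  then have "norm (scaleC_op (z - ?a) id_blinfun + rank1 x y) / (cmod z * cmod (z - ?a))
    \<le> norm (scaleC_op (?a - z - ?a) id_blinfun + rank1 x y) / (cmod z * cmod (z - ?a))"
    by (rule divide_right_mono) simp
  moreover have "cmod (?a - z) * cmod (?a - z - ?a) = cmod z * cmod (z - ?a)"
    by (simp add: norm_minus_commute)
  moreover have "inverse \<epsilon>
    < norm (scaleC_op (z - ?a) id_blinfun + rank1 x y) / (cmod z * cmod (z - ?a))"
    using z False rank1_pseudo_spectrum_iff[of z y x \<epsilon>] by blast
  moreover have "?a - z \<noteq> 0" "?a - z \<noteq> ?a" using False by auto
  ultimately show ?thesis
    by (simp only: rank1_pseudo_spectrum_iff[of "?a - z" y x \<epsilon>] if_False simp_thms)
qed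

lemma rank1_pseudo_spectrum_bounded:
  fixes x y :: "'a::complex_hilbert_space"
  assumes eps: "\<epsilon> > 0"
  shows "\<exists>K. \<forall>z \<in> pseudo_spectrum \<epsilon> (rank1 x y). cmod z \<le> K"
proof -
  let ?a = "cinner y x" and ?n = "norm (rank1 x y)"
  define K where "K = cmod ?a + 1 + \<epsilon> * (1 + ?n)"
  have "cmod z \<le> K" if z: "z \<in> pseudo_spectrum \<epsilon> (rank1 x y)" for z
  proof (rule ccontr)
    assume K: "\<not> cmod z \<le> K"
    have en: "\<epsilon> * (1 + ?n) \<ge> 0" using eps by simp
    have z1: "cmod (z - ?a) \<ge> 1"
      using K en norm_triangle_ineq2[of z ?a] by (simp add: K_def)
    have zz: "cmod z > \<epsilon> * (1 + ?n)" using K norm_ge_zero[of ?a] unfolding K_def by linarith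
    then have z0: "cmod z > 0" using en by linarith
    have ne: "z \<noteq> 0" "z \<noteq> ?a" using z0 z1 by auto
    have "norm (scaleC_op (z - ?a) id_blinfun + rank1 x y) \<le> cmod (z - ?a) + ?n"
      by (rule norm_scaleC_id_add_le)
    also have "\<dots> \<le> cmod (z - ?a) * (1 + ?n)"
      using z1 mult_right_mono[of 1 "cmod (z - ?a)" ?n] by (simp add: algebra_simps)
    finally have "norm (scaleC_op (z - ?a) id_blinfun + rank1 x y) / (cmod z * cmod (z - ?a))
      \<le> (1 + ?n) / cmod z"
      using z0 z1 by (simp add: divide_simps) (simp add: mult_ac mult_left_mono)
    also have "\<dots> \<le> inverse \<epsilon>" using zz z0 eps by (simp add: field_simps)
    finally show False using z rank1_pseudo_spectrum_iff[OF ne] by simp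
  qed
  then show ?thesis by blast
qed

text \<open>
  The composition of two distinct point reflections is a translation, which leaves no nonempty
  bounded set invariant.
\<close>

lemma center_of_symmetry_unique:
  fixes Z :: "complex set"
  assumes ne: "Z \<noteq> {}" and bdd: "\<And>z. z \<in> Z \<Longrightarrow> cmod z \<le> K"
    and a: "\<And>z. z \<in> Z \<Longrightarrow> a - z \<in> Z" and b: "\<And>z. z \<in> Z \<Longrightarrow> b - z \<in> Z"
  shows "a = b"
proof (rule ccontr)
  assume ab: "a \<noteq> b"
  obtain z where z: "z \<in> Z" using ne by blast
  have mem: "z + of_nat n * (a - b) \<in> Z" for n
  proof (induction n)
    case (Suc n)
    then show ?case using a[OF b[OF Suc.IH]] by (simp add: algebra_simps)
  qed (simp add: z)
  obtain n where n: "(K + cmod z) / cmod (a - b) < real n" using reals_Archimedean2 by blast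
  then have "K + cmod z < cmod (of_nat n * (a - b))"
    using ab by (simp add: pos_divide_less_eq norm_mult)
  also have "\<dots> \<le> cmod (z + of_nat n * (a - b)) + cmod z"
    using norm_triangle_ineq4[of "z + of_nat n * (a - b)" z] by simp
  also have "\<dots> \<le> K + cmod z" using bdd[OF mem] by simp
  finally show False by simp
qed

lemma rank1_pseudo_spectrum_center:
  fixes x y :: "'a::complex_hilbert_space"
  assumes dim: "\<exists>S :: 'a set. card S = 3 \<and> complex_vector.independent S"
    and eps: "\<epsilon> > 0"
    and sym: "\<And>z. z \<in> pseudo_spectrum \<epsilon> (rank1 x y) \<Longrightarrow> c - z \<in> pseudo_spectrum \<epsilon> (rank1 x y)"
  shows "cinner y x = c"
proof -
  obtain K where K: "\<forall>z \<in> pseudo_spectrum \<epsilon> (rank1 x y). cmod z \<le> K"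
    using rank1_pseudo_spectrum_bounded[OF eps] by blast
  show ?thesis
  proof (rule center_of_symmetry_unique[OF _ _ _ sym])
    show "pseudo_spectrum \<epsilon> (rank1 x y) \<noteq> {}"
      using rank1_spectrum_in_pseudo_spectrum[OF dim eps] by blast
  qed (use K rank1_pseudo_spectrum_symmetric[OF dim eps] in blast)+
qed

text \<open>
  The trace of a rank-one operator is twice the centre of symmetry of its pseudospectrum.
\<close>

lemma trace_determined_by_pseudo_spectrum:
  fixes x y x' y' :: "'a::complex_hilbert_space"
  assumes dim: "\<exists>S :: 'a set. card S = 3 \<and> complex_vector.independent S"
    and eps: "\<epsilon> > 0"
    and eq: "pseudo_spectrum \<epsilon> (rank1 x y) = pseudo_spectrum \<epsilon> (rank1 x' y')"
  shows "cinner y x = cinner y' x'"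
  using rank1_pseudo_spectrum_symmetric[OF dim eps, of _ x' y']
  by (intro rank1_pseudo_spectrum_center[OF dim eps]) (simp only: eq)

lemma rank1_zero [simp]: "rank1 0 y = 0" "rank1 x 0 = 0"
  by (rule blinfun_eqI, simp add: op_apply)+

lemma rank1_eq_0_iff: "rank1 x y = 0 \<longleftrightarrow> x = 0 \<or> y = 0"
proof
  assume "rank1 x y = 0"
  then have "cinner y y *\<^sub>C x = 0" by (metis rank1.rep_eq zero_blinfun.rep_eq)
  then show "x = 0 \<or> y = 0" by auto
qed auto

text \<open>
  The pseudospectrum of \<open>0\<close> is the open disc of radius \<open>\<epsilon>\<close>.  If \<open>T = x y\<^sup>* \<noteq> 0\<close> has trace \<open>0\<close>, its
  pseudospectrum contains the boundary point \<open>\<epsilon>\<close>, since \<open>(\<epsilon> + T) y\<close> is longer than \<open>\<epsilon> y\<close> by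
  orthogonality of \<open>x\<close> and \<open>y\<close>.
\<close>

lemma rank1_zero_if_pseudo_spectrum_zero:
  fixes x y :: "'a::complex_hilbert_space"
  assumes dim: "\<exists>S :: 'a set. card S = 3 \<and> complex_vector.independent S"
    and eps: "\<epsilon> > 0"
    and eq: "pseudo_spectrum \<epsilon> (rank1 x y) = pseudo_spectrum \<epsilon> (0 :: 'a \<Rightarrow>\<^sub>L 'a)"
  shows "rank1 x y = 0"
proof (rule ccontr)
  assume "rank1 x y \<noteq> 0"
  then have x: "x \<noteq> 0" and y: "y \<noteq> 0" by auto
  let ?e = "complex_of_real \<epsilon>"
  have "cinner y x = cinner 0 (0 :: 'a)"
    by (rule trace_determined_by_pseudo_spectrum[OF dim eps]) (simp add: eq)
  then have yx: "cinner y x = 0" by simp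
  have e0: "?e \<noteq> 0" using eps by simp
  have "?e \<notin> pseudo_spectrum \<epsilon> (rank1 0 (0 :: 'a))"
    using rank1_pseudo_spectrum_iff[of ?e "0::'a" 0 \<epsilon>] norm_scaleC_id_add_le[of ?e "0 :: 'a \<Rightarrow>\<^sub>L 'a"] e0 eps
    by (simp add: field_simps not_less)
  then have "norm (scaleC_op ?e id_blinfun + rank1 x y) \<le> \<epsilon>"
    using eq rank1_pseudo_spectrum_iff[of ?e y x \<epsilon>] e0 eps yx by (simp add: field_simps not_less)
  then have "norm (blinfun_apply (scaleC_op ?e id_blinfun + rank1 x y) y) \<le> \<epsilon> * norm y"
    using norm_blinfun mult_right_mono norm_ge_zero order_trans by blast
  then have "(norm (?e *\<^sub>C y + cinner y y *\<^sub>C x))\<^sup>2 \<le> (\<epsilon> * norm y)\<^sup>2"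
    by (intro power_mono) (simp_all add: op_apply)
  moreover have "(norm (?e *\<^sub>C y + cinner y y *\<^sub>C x))\<^sup>2
    = (\<epsilon> * norm y)\<^sup>2 + (norm (cinner y y *\<^sub>C x))\<^sup>2"
    using eps by (subst norm_add_sq_orthogonal) (simp_all add: cinner_simps yx norm_scaleC)
  ultimately have "(norm (cinner y y *\<^sub>C x))\<^sup>2 \<le> 0" by linarith
  then show False using x y by simp
qed

section \<open>Recognising rank one\<close>

text \<open>
  This is the pseudospectrum of a selfadjoint operator with spectrum \<open>{0, 4 \<epsilon>, 8 \<epsilon>}\<close>.  The three
  points are equidistant, so that the set is symmetric about \<open>4 \<epsilon>\<close>, and the gap \<open>4 \<epsilon>\<close> is wide
  enough for a normal rank-one operator with eigenvalues \<open>0\<close> and \<open>8 \<epsilon>\<close> to have a small resolvent halfway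
  between them.
\<close>

definition three_discs :: "real \<Rightarrow> complex set" where
  "three_discs \<epsilon> = {z. cmod z < \<epsilon> \<or> cmod (z - of_real (4 * \<epsilon>)) < \<epsilon> \<or> cmod (z - of_real (8 * \<epsilon>)) < \<epsilon>}"

text \<open>
  The symmetry about \<open>4 \<epsilon>\<close> gives \<open>x y\<^sup>*\<close> the trace \<open>8 \<epsilon>\<close>.  The boundary point \<open>9 \<epsilon>\<close> does not belong to the
  set, which is possible only if the norm of \<open>x y\<^sup>*\<close> does not exceed its trace.  But then the resolvent at
  \<open>4 \<epsilon>\<close> has norm at most \<open>12 \<epsilon> / (4 \<epsilon>)\<^sup>2 < 1 / \<epsilon>\<close>, so the middle disc is missing.
\<close>

lemma rank1_pseudo_spectrum_neq_three_discs:
  fixes x y :: "'a::complex_hilbert_space"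
  assumes dim: "\<exists>S :: 'a set. card S = 3 \<and> complex_vector.independent S"
    and eps: "\<epsilon> > 0"
  shows "pseudo_spectrum \<epsilon> (rank1 x y) \<noteq> three_discs \<epsilon>"
proof
  assume eq: "pseudo_spectrum \<epsilon> (rank1 x y) = three_discs \<epsilon>"
  let ?a = "complex_of_real (8 * \<epsilon>)"
  have a: "cinner y x = ?a"
  proof (rule rank1_pseudo_spectrum_center[OF dim eps])
    fix z assume "z \<in> pseudo_spectrum \<epsilon> (rank1 x y)"
    moreover have "cmod (?a - z) = cmod (z - ?a)" "cmod (?a - z - ?a) = cmod z"
      "cmod (?a - z - of_real (4 * \<epsilon>)) = cmod (z - of_real (4 * \<epsilon>))"
      using norm_minus_commute[of "of_real (4 * \<epsilon>)" z] by (simp_all add: norm_minus_commute)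
    ultimately show "?a - z \<in> pseudo_spectrum \<epsilon> (rank1 x y)"
      by (auto simp only: eq three_discs_def mem_Collect_eq)
  qed
  have y: "y \<noteq> 0" using a eps by auto
  have xy: "norm x * norm y \<le> 8 * \<epsilon>"
  proof -
    let ?z = "complex_of_real (9 * \<epsilon>)"
    let ?u = "complex_of_real \<epsilon> *\<^sub>C y" and ?w = "cinner y y *\<^sub>C x"
    have "?z - ?a = complex_of_real \<epsilon>" "?z - of_real (4 * \<epsilon>) = of_real (5 * \<epsilon>)"
      by (simp_all flip: of_real_diff)
    then have za: "?z - ?a = complex_of_real \<epsilon>" "cmod (?z - ?a) = \<epsilon>"
      "cmod (?z - of_real (4 * \<epsilon>)) = 5 * \<epsilon>" "cmod ?z = 9 * \<epsilon>"
      using eps by (simp_all only: norm_of_real abs_of_pos mult_pos_pos zero_less_numeral)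
    have "?z \<notin> three_discs \<epsilon>"
      using eps by (simp only: three_discs_def mem_Collect_eq za) simp
    moreover have "?z \<noteq> 0" "?z \<noteq> ?a" using eps by auto
    ultimately have "norm (scaleC_op \<epsilon> id_blinfun + rank1 x y) \<le> 9 * \<epsilon>"
      using rank1_pseudo_spectrum_iff[of ?z y x \<epsilon>] eps
      by (simp only: eq a za) (simp add: field_simps not_less)
    then have "norm (blinfun_apply (scaleC_op \<epsilon> id_blinfun + rank1 x y) y) \<le> 9 * \<epsilon> * norm y"
      using norm_blinfun mult_right_mono norm_ge_zero order_trans by blast
    then have "(norm (?u + ?w))\<^sup>2 \<le> (9 * \<epsilon> * norm y)\<^sup>2"
      by (intro power_mono) (simp_all add: op_apply)
    moreover have "Re (cinner ?u ?w) = 8 * (\<epsilon> * norm y)\<^sup>2"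
      by (simp add: cinner_simps a cinner_self power2_eq_square)
    moreover have "norm ?u = \<epsilon> * norm y"
      using eps by (simp add: norm_scaleC)
    moreover have "norm ?w = norm y * (norm x * norm y)"
      unfolding cinner_self by (simp only: norm_scaleC norm_of_real) (simp add: power2_eq_square)
    ultimately have "(norm y * (norm x * norm y))\<^sup>2 \<le> (norm y * (8 * \<epsilon>))\<^sup>2"
      unfolding norm_add_sq[of ?u ?w] by (simp add: power_mult_distrib mult_ac)
    then have "norm y * (norm x * norm y) \<le> norm y * (8 * \<epsilon>)"
      by (rule power2_le_imp_le) (use eps in simp)
    then show ?thesis using y by simp
  qed
  let ?t = "complex_of_real (4 * \<epsilon>)"
  have "?t - ?a = - ?t" by simp
  then have ta: "?t - ?a = - ?t" "cmod (?t - ?a) = 4 * \<epsilon>" "cmod ?t = 4 * \<epsilon>"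
    using eps by (simp_all only: norm_minus_cancel norm_of_real abs_of_pos mult_pos_pos zero_less_numeral)
  have "norm (scaleC_op (- ?t) id_blinfun + rank1 x y) \<le> 4 * \<epsilon> + 8 * \<epsilon>"
    using norm_scaleC_id_add_le[of "- ?t" "rank1 x y"] xy norm_rank1_le[of x y] ta by simp
  moreover have "?t \<noteq> 0" "?t \<noteq> ?a" using eps by auto
  ultimately have "?t \<notin> pseudo_spectrum \<epsilon> (rank1 x y)"
    using rank1_pseudo_spectrum_iff[of ?t y x \<epsilon>] eps
    by (simp only: a ta) (simp add: field_simps not_less)
  moreover have "?t \<in> three_discs \<epsilon>" using eps by (simp add: three_discs_def)
  ultimately show False using eq by simp
qed

text \<open>
  The operator is diagonal, so its resolvent is as large as the largest of \<open>1 / \<bar>z\<bar>\<close>, \<open>1 / \<bar>z - a\<bar>\<close> and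
  \<open>1 / \<bar>z - b\<bar>\<close>.  The eigenvalue \<open>0\<close> is present because some nonzero vector is orthogonal to \<open>p\<close> and \<open>q\<close>.
\<close>

lemma pseudo_spectrum_diagonal:
  fixes p q :: "'a::complex_hilbert_space"
  assumes dim: "\<exists>S :: 'a set. card S = 3 \<and> complex_vector.independent S"
    and eps: "\<epsilon> > 0" and p: "norm p = 1" and q: "norm q = 1" and pq: "cinner p q = 0"
  shows "pseudo_spectrum \<epsilon> (rank1 (a *\<^sub>C p) p + rank1 (b *\<^sub>C q) q)
    = {z. cmod z < \<epsilon> \<or> cmod (z - a) < \<epsilon> \<or> cmod (z - b) < \<epsilon>}" (is "pseudo_spectrum \<epsilon> ?M = _")
proof -
  have qp: "cinner q p = 0" using pq by (simp add: cinner_eq_0_commute)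
  have pp: "cinner p p = 1" and qq: "cinner q q = 1" using p q by (simp_all add: cinner_self)
  obtain v where v: "v \<noteq> 0" "cinner p v = 0" "cinner q v = 0"
    using exists_orthogonal_to_two[OF dim] by blast
  have M: "blinfun_apply ?M u = (a * cinner p u) *\<^sub>C p + (b * cinner q u) *\<^sub>C q" for u
    by (simp add: op_apply scaleC_scaleC mult.commute)
  have eig: "blinfun_apply ?M v = 0 *\<^sub>C v" "blinfun_apply ?M p = a *\<^sub>C p"
    "blinfun_apply ?M q = b *\<^sub>C q"
    unfolding M by (simp_all add: v pp qq pq qp)
  have nz: "p \<noteq> 0" "q \<noteq> 0" using p q by auto
  have "z \<notin> pseudo_spectrum \<epsilon> ?M"
    if z: "\<not> cmod z < \<epsilon>" "\<not> cmod (z - a) < \<epsilon>" "\<not> cmod (z - b) < \<epsilon>" for z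
  proof -
    define k l m where "k = 1 / z" and "l = 1 / (z - a)" and "m = 1 / (z - b)"
    have "z \<noteq> 0" "z - a \<noteq> 0" "z - b \<noteq> 0" using z eps by force+
    then have klm: "k * z = 1" "l * (z - a) = 1" "m * (z - b) = 1"
      by (simp_all add: k_def l_def m_def)
    \<comment> \<open>working with the reciprocals as variables keeps the identities for the inverse polynomial\<close>
    have kl: "(l - k) * (z - a) = k * a" "(m - k) * (z - b) = k * b"
      using klm by (simp_all add: algebra_simps)
    define R where "R = scaleC_op k id_blinfun + rank1 ((l - k) *\<^sub>C p) p + rank1 ((m - k) *\<^sub>C q) q"
    have R: "blinfun_apply R u = k *\<^sub>C u + ((l - k) * cinner p u) *\<^sub>C p + ((m - k) * cinner q u) *\<^sub>C q"
      for u by (simp add: R_def op_apply scaleC_scaleC mult.commute)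
    have prods: "cinner w (blinfun_apply R (z *\<^sub>C u - blinfun_apply ?M u))
        = (k * z) * cinner w u + ((l - k) * (z - a) - k * a) * (cinner p u * cinner w p)
          + ((m - k) * (z - b) - k * b) * (cinner q u * cinner w q)"
      "cinner w (z *\<^sub>C blinfun_apply R u - blinfun_apply ?M (blinfun_apply R u))
        = (k * z) * cinner w u + ((l - k) * (z - a) - k * a) * (cinner p u * cinner w p)
          + ((m - k) * (z - b) - k * b) * (cinner q u * cinner w q)" for u w
      unfolding M R by (simp_all add: cinner_simps pp qq pq qp algebra_simps)
    have inv: "is_inverse_op (scaleC_op z id_blinfun - ?M) R"
      unfolding is_inverse_op_def
    proof (intro conjI blinfun_eqI cinner_ext)
      show "R \<in> bounded_operators" unfolding R_def by blast
      fix u w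
      show "cinner w (blinfun_apply (R o\<^sub>L (scaleC_op z id_blinfun - ?M)) u)
          = cinner w (blinfun_apply id_blinfun u)"
        using prods(1)[of w u] klm kl
        by (simp add: blinfun.diff_left scaleC_op.rep_eq)
      show "cinner w (blinfun_apply ((scaleC_op z id_blinfun - ?M) o\<^sub>L R) u)
          = cinner w (blinfun_apply id_blinfun u)"
        using prods(2)[of w u] klm kl
        by (simp add: blinfun.diff_left scaleC_op.rep_eq)
    qed
    have bnd: "cmod k \<le> inverse \<epsilon>" "cmod l \<le> inverse \<epsilon>" "cmod m \<le> inverse \<epsilon>"
      using z eps by (simp_all add: k_def l_def m_def norm_divide inverse_eq_divide frac_le)
    have "norm R \<le> inverse \<epsilon>"
    proof (rule norm_blinfun_bound)
      fix u
      let ?c = "cinner p u" and ?d = "cinner q u"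
      define r where "r = u - ?c *\<^sub>C p - ?d *\<^sub>C q"
      have r: "cinner p r = 0" "cinner q r = 0"
        by (simp_all add: r_def cinner_simps pp qq pq qp)
      then have r': "cinner r p = 0" "cinner r q = 0" by (simp_all add: cinner_eq_0_commute)
      have split: "(norm (e *\<^sub>C r + (f *\<^sub>C p + g *\<^sub>C q)))\<^sup>2
          = (cmod e)\<^sup>2 * (norm r)\<^sup>2 + ((cmod f)\<^sup>2 + (cmod g)\<^sup>2)" for e f g
        by (subst norm_add_sq_orthogonal)
          (simp_all add: cinner_simps r' norm_orthonormal_combination[OF p q pq] norm_scaleC
            power_mult_distrib)
      have u: "u = 1 *\<^sub>C r + (?c *\<^sub>C p + ?d *\<^sub>C q)" by (simp add: r_def scaleC_one)
      have Ru: "blinfun_apply R u = k *\<^sub>C r + ((l * ?c) *\<^sub>C p + (m * ?d) *\<^sub>C q)"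
        unfolding R by (rule cinner_ext) (simp add: r_def cinner_simps algebra_simps)
      have sq: "(cmod k)\<^sup>2 \<le> (inverse \<epsilon>)\<^sup>2" "(cmod l)\<^sup>2 \<le> (inverse \<epsilon>)\<^sup>2" "(cmod m)\<^sup>2 \<le> (inverse \<epsilon>)\<^sup>2"
        using bnd by (auto intro: power_mono)
      have "(norm (blinfun_apply R u))\<^sup>2
          = (cmod k)\<^sup>2 * (norm r)\<^sup>2 + ((cmod l)\<^sup>2 * (cmod ?c)\<^sup>2 + (cmod m)\<^sup>2 * (cmod ?d)\<^sup>2)"
        unfolding Ru split by (simp add: norm_mult power_mult_distrib)
      also have "\<dots> \<le> (inverse \<epsilon>)\<^sup>2 * (norm r)\<^sup>2
          + ((inverse \<epsilon>)\<^sup>2 * (cmod ?c)\<^sup>2 + (inverse \<epsilon>)\<^sup>2 * (cmod ?d)\<^sup>2)"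
        by (intro add_mono mult_right_mono sq) simp_all
      also have "\<dots> = (inverse \<epsilon>)\<^sup>2 * ((cmod 1)\<^sup>2 * (norm r)\<^sup>2 + ((cmod ?c)\<^sup>2 + (cmod ?d)\<^sup>2))"
        by (simp add: algebra_simps)
      also have "\<dots> = (inverse \<epsilon>)\<^sup>2 * (norm u)\<^sup>2"
        using split[of 1 ?c ?d] unfolding u[symmetric] by simp
      also have "\<dots> = (inverse \<epsilon> * norm u)\<^sup>2" by (simp add: power_mult_distrib)
      finally show "norm (blinfun_apply R u) \<le> inverse \<epsilon> * norm u"
        by (rule power2_le_imp_le) (use eps in simp)
    qed (use eps in simp)
    then show ?thesis using pseudo_spectrum_iff_inverse[OF inv, of \<epsilon>] by simp
  qed
  moreover have "z \<in> pseudo_spectrum \<epsilon> ?M"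
    if "cmod z < \<epsilon> \<or> cmod (z - a) < \<epsilon> \<or> cmod (z - b) < \<epsilon>" for z
    using that near_eigenvalue_in_pseudo_spectrum[OF eig(1) v(1), of z \<epsilon>]
      near_eigenvalue_in_pseudo_spectrum[OF eig(2) nz(1), of z \<epsilon>]
      near_eigenvalue_in_pseudo_spectrum[OF eig(3) nz(2), of z \<epsilon>] by auto
  ultimately show ?thesis by blast
qed

text \<open>
  The range of the adjoint of an operator of rank at least two is not a line.  Given a unit vector
  \<open>p\<close> in that range, \<open>B\<close> does not vanish on the complement of \<open>p\<close>; and if \<open>B v' \<noteq> 0\<close> with \<open>v'\<close>
  orthogonal to \<open>p\<close>, then \<open>B\<^sup>* B v'\<close> is not a multiple of \<open>p\<close>, having inner product
  \<open>\<parallel>B v'\<parallel>\<^sup>2\<close> with \<open>v'\<close>.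
\<close>

lemma orthonormal_pair_in_adjoint_range:
  fixes B :: "'a::complex_hilbert_space \<Rightarrow>\<^sub>L 'a"
  assumes B: "B \<in> bounded_operators" and rank: "\<nexists>x y. B = rank1 x y"
  obtains w w' where "norm (blinfun_apply (adjoint_op B) w) = 1"
    "norm (blinfun_apply (adjoint_op B) w') = 1"
    "cinner (blinfun_apply (adjoint_op B) w) (blinfun_apply (adjoint_op B) w') = 0"
proof -
  let ?B = "adjoint_op B"
  have Bb: "?B \<in> bounded_operators" by (rule adjoint_op_bounded[OF B])
  have normalize: "\<exists>c. norm (blinfun_apply ?B (c *\<^sub>C w)) = 1" if "blinfun_apply ?B w \<noteq> 0" for w
    using norm_normalized[OF that] by (metis bounded_operatorsD[OF Bb])
  have "\<exists>u. blinfun_apply B u \<noteq> 0"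
  proof (rule ccontr)
    assume "\<nexists>u. blinfun_apply B u \<noteq> 0"
    then have "B = rank1 0 0" by (intro blinfun_eqI) simp
    then show False using rank by blast
  qed
  then obtain u where u: "blinfun_apply B u \<noteq> 0" by blast
  have "cinner u (blinfun_apply ?B (blinfun_apply B u)) \<noteq> 0"
    using u by (simp add: cinner_adjoint_op[OF B])
  then have "blinfun_apply ?B (blinfun_apply B u) \<noteq> 0" by auto
  then obtain w where w: "norm (blinfun_apply ?B w) = 1"
    using normalize[of "blinfun_apply B u"] by blast
  define p where "p = blinfun_apply ?B w"
  have pp: "cinner p p = 1" using w by (simp add: p_def cinner_self)
  have "\<exists>v. blinfun_apply B (v - cinner p v *\<^sub>C p) \<noteq> 0"
  proof (rule ccontr)
    assume "\<nexists>v. blinfun_apply B (v - cinner p v *\<^sub>C p) \<noteq> 0"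
    then have "blinfun_apply B v = blinfun_apply (rank1 (blinfun_apply B p) p) v" for v
      by (metis op_apply(1) blinfun.diff_right bounded_operatorsD[OF B] eq_iff_diff_eq_0)
    then have "B = rank1 (blinfun_apply B p) p" by (rule blinfun_eqI)
    then show False using rank by blast
  qed
  then obtain v where v: "blinfun_apply B (v - cinner p v *\<^sub>C p) \<noteq> 0" by blast
  define v' where "v' = v - cinner p v *\<^sub>C p"
  have pv': "cinner p v' = 0" by (simp add: v'_def cinner_simps pp)
  then have v'p: "cinner v' p = 0" by (simp add: cinner_eq_0_commute)
  define y where "y = blinfun_apply ?B (blinfun_apply B v')"
  define w1 where "w1 = blinfun_apply B v' - cinner p y *\<^sub>C w"
  have Bw1: "blinfun_apply ?B w1 = y - cinner p y *\<^sub>C p"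
    by (simp add: w1_def y_def p_def blinfun.diff_right bounded_operatorsD[OF Bb])
  have orth: "cinner p (blinfun_apply ?B w1) = 0" by (simp add: Bw1 cinner_simps pp)
  have "cinner v' (blinfun_apply ?B w1) = cinner (blinfun_apply B v') (blinfun_apply B v')"
    by (simp add: Bw1 cinner_simps v'p) (simp add: y_def cinner_adjoint_op[OF B])
  then have "blinfun_apply ?B w1 \<noteq> 0" using v by (auto simp: v'_def)
  then obtain c where "norm (blinfun_apply ?B (c *\<^sub>C w1)) = 1" using normalize[of w1] by blast
  moreover have "cinner p (blinfun_apply ?B (c *\<^sub>C w1)) = 0"
    by (simp add: bounded_operatorsD[OF Bb] cinner_simps orth)
  ultimately show ?thesis using that w unfolding p_def by blast
qed

text \<open>
  A right factor of rank one forces the product to have rank at most one.  Otherwise, orthonormal vectors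
  \<open>B\<^sup>* w\<close> and \<open>B\<^sup>* w'\<close> allow one to choose \<open>A\<close> with range spanned by \<open>w\<close> and \<open>w'\<close> such that
  \<open>A\<^sup>* B\<close> is diagonal with eigenvalues \<open>4 \<epsilon>\<close> and \<open>8 \<epsilon>\<close>.
\<close>

lemma rank1_iff_never_three_discs:
  fixes B :: "'a::complex_hilbert_space \<Rightarrow>\<^sub>L 'a"
  assumes dim: "\<exists>S :: 'a set. card S = 3 \<and> complex_vector.independent S"
    and eps: "\<epsilon> > 0" and B: "B \<in> bounded_operators"
  shows "(\<exists>x y. B = rank1 x y) \<longleftrightarrow>
    (\<forall>A \<in> bounded_operators. pseudo_spectrum \<epsilon> (adjoint_op A o\<^sub>L B) \<noteq> three_discs \<epsilon>)"
proof
  assume "\<exists>x y. B = rank1 x y"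
  then show "\<forall>A \<in> bounded_operators. pseudo_spectrum \<epsilon> (adjoint_op A o\<^sub>L B) \<noteq> three_discs \<epsilon>"
    using rank1_pseudo_spectrum_neq_three_discs[OF dim eps]
    by (auto simp: compose_rank1 adjoint_op_bounded)
next
  assume never: "\<forall>A \<in> bounded_operators. pseudo_spectrum \<epsilon> (adjoint_op A o\<^sub>L B) \<noteq> three_discs \<epsilon>"
  show "\<exists>x y. B = rank1 x y"
  proof (rule ccontr)
    assume "\<nexists>x y. B = rank1 x y"
    then obtain w w' where w: "norm (blinfun_apply (adjoint_op B) w) = 1"
      "norm (blinfun_apply (adjoint_op B) w') = 1"
      "cinner (blinfun_apply (adjoint_op B) w) (blinfun_apply (adjoint_op B) w') = 0"
      using orthonormal_pair_in_adjoint_range[OF B] by blast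
    let ?p = "blinfun_apply (adjoint_op B) w" and ?q = "blinfun_apply (adjoint_op B) w'"
    let ?a = "complex_of_real (4 * \<epsilon>)" and ?b = "complex_of_real (8 * \<epsilon>)"
    define A where "A = rank1 w (?a *\<^sub>C ?p) + rank1 w' (?b *\<^sub>C ?q)"
    have A: "A \<in> bounded_operators" unfolding A_def by blast
    have "adjoint_op A = rank1 (?a *\<^sub>C ?p) w + rank1 (?b *\<^sub>C ?q) w'"
    proof (rule adjoint_op_eqI)
      fix x y
      show "cinner (blinfun_apply A x) y
          = cinner x (blinfun_apply (rank1 (?a *\<^sub>C ?p) w + rank1 (?b *\<^sub>C ?q) w') y)"
        using cinner_commute[of x ?p] cinner_commute[of x ?q]
        by (simp add: A_def op_apply cinner_simps)
    qed blast
    then have "adjoint_op A o\<^sub>L B = rank1 (?a *\<^sub>C ?p) ?p + rank1 (?b *\<^sub>C ?q) ?q"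
      by (intro blinfun_eqI) (simp add: op_apply cinner_adjoint_op_left[OF B])
    then have "pseudo_spectrum \<epsilon> (adjoint_op A o\<^sub>L B) = three_discs \<epsilon>"
      unfolding three_discs_def by (simp only: pseudo_spectrum_diagonal[OF dim eps w])
    then show False using never A by blast
  qed
qed

section \<open>Unitary operators\<close>

text \<open>
  Linearity comes for free: the vectors \<open>U x\<close> separate points, and \<open>\<langle>U z, U x\<rangle> = \<langle>z, x\<rangle>\<close> is linear
  in \<open>x\<close>.
\<close>

lemma isometry_with_total_range_is_unitary:
  fixes U :: "'a::complex_hilbert_space \<Rightarrow> 'a"
  assumes iso: "\<And>x y. cinner (U x) (U y) = cinner x y"
    and total: "\<And>f. \<exists>c x. f = c *\<^sub>C U x"
  obtains T where "unitary_op T" "\<And>x. blinfun_apply T x = U x"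
proof -
  have ext: "a = b" if "\<And>x. cinner (U x) a = cinner (U x) b" for a b
  proof (rule cinner_ext)
    fix z
    obtain c x where "z = c *\<^sub>C U x" using total by blast
    then show "cinner z a = cinner z b" by (simp add: cinner_scaleC_left that)
  qed
  have scale: "U (c *\<^sub>C x) = c *\<^sub>C U x" for c x
    by (rule ext) (simp add: iso cinner_simps)
  have "bounded_linear U"
  proof (rule bounded_linear_intro[where K = 1])
    show "U (x + y) = U x + U y" for x y
      by (rule ext) (simp add: iso cinner_simps)
    show "U (r *\<^sub>R x) = r *\<^sub>R U x" for r x
      by (rule ext) (simp add: iso cinner_simps)
    show "norm (U x) \<le> norm x * 1" for x
      using norm_eq_if_cinner_eq[OF iso[of x x]] by simp
  qed
  define T where "T = Blinfun U"
  have T: "blinfun_apply T x = U x" for x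
    unfolding T_def by (simp add: bounded_linear_Blinfun_apply[OF \<open>bounded_linear U\<close>])
  have Tb: "T \<in> bounded_operators" by (simp add: bounded_operators_def T scale)
  have left: "blinfun_apply (adjoint_op T) (blinfun_apply T x) = x" for x
    by (rule cinner_ext) (simp add: cinner_adjoint_op[OF Tb] T iso)
  have right: "blinfun_apply T (blinfun_apply (adjoint_op T) f) = f" for f
  proof -
    obtain c x where "f = c *\<^sub>C U x" using total by blast
    then have "f = blinfun_apply T (c *\<^sub>C x)" by (simp add: T scale)
    then show ?thesis by (simp add: left)
  qed
  have "unitary_op T"
    unfolding unitary_op_def using Tb left right by (auto intro!: blinfun_eqI)
  then show ?thesis using that T by blast
qed

lemma unitary_op_adjoint:
  fixes T :: "'a::complex_hilbert_space \<Rightarrow>\<^sub>L 'a"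
  assumes "unitary_op T"
  shows "unitary_op (adjoint_op T)"
proof -
  have Tb: "T \<in> bounded_operators" using assms by (simp add: unitary_op_def)
  have "adjoint_op (adjoint_op T) = T"
    by (rule adjoint_op_eqI[OF Tb]) (rule cinner_adjoint_op_left[OF Tb])
  then show ?thesis using assms adjoint_op_bounded[OF Tb] by (simp add: unitary_op_def)
qed

section \<open>Preservers of the pseudospectrum of \<open>A\<^sup>* B\<close>\<close>

lemma proportional_if_orthogonal:
  fixes u v :: "'a::complex_hilbert_space"
  assumes "\<And>h. cinner h u = 0 \<Longrightarrow> h \<noteq> 0 \<Longrightarrow> cinner h v = 0"
  shows "\<exists>c. v = c *\<^sub>C u"
proof -
  define h where "h = v - (cinner u v / cinner u u) *\<^sub>C u"
  have "cinner u h = 0" unfolding h_def by (rule orthogonal_part)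
  then have hu: "cinner h u = 0" by (simp add: cinner_eq_0_commute)
  have "h = 0"
  proof (rule ccontr)
    assume "h \<noteq> 0"
    moreover from this have "cinner h v = 0" by (rule assms[OF hu])
    moreover have "cinner h h = cinner h v - (cinner u v / cinner u u) * cinner h u"
      by (subst (2) h_def) (simp add: cinner_simps)
    ultimately show False by (simp add: hu)
  qed
  then have "v = (cinner u v / cinner u u) *\<^sub>C u" by (simp add: h_def)
  then show ?thesis by blast
qed

lemma exists_nonorthogonal_to_both:
  fixes f g :: "'a::complex_hilbert_space"
  assumes "f \<noteq> 0" "g \<noteq> 0"
  obtains u where "cinner u f \<noteq> 0" "cinner u g \<noteq> 0"
proof (cases "cinner f g = 0")
  case True
  then have "cinner g f = 0" by (simp add: cinner_eq_0_commute)
  then show ?thesis using True assms by (intro that[of "f + g"]) (simp_all add: cinner_simps)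
qed (use assms in \<open>auto intro: that[of f]\<close>)

lemma rank1_scaleC: "rank1 (c *\<^sub>C x) y = rank1 x (cnj c *\<^sub>C y)"
  by (rule blinfun_eqI) (simp add: op_apply cinner_simps scaleC_scaleC mult.commute)

locale pseudo_spectrum_preserver =
  fixes \<Phi> :: "('a::complex_hilbert_space \<Rightarrow>\<^sub>L 'a) \<Rightarrow> ('a \<Rightarrow>\<^sub>L 'a)" and \<epsilon> :: real
  assumes dim: "\<exists>S :: 'a set. card S = 3 \<and> complex_vector.independent S"
    and eps: "\<epsilon> > 0"
    and surj: "\<Phi> ` bounded_operators = bounded_operators"
    and pres: "\<And>A B. A \<in> bounded_operators \<Longrightarrow> B \<in> bounded_operators \<Longrightarrow>
      pseudo_spectrum \<epsilon> (adjoint_op (\<Phi> A) o\<^sub>L \<Phi> B) = pseudo_spectrum \<epsilon> (adjoint_op A o\<^sub>L B)"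
begin

lemma image_bounded: "A \<in> bounded_operators \<Longrightarrow> \<Phi> A \<in> bounded_operators"
  using surj by blast

lemma rank1_image_iff:
  assumes "B \<in> bounded_operators"
  shows "(\<exists>f g. \<Phi> B = rank1 f g) \<longleftrightarrow> (\<exists>x y. B = rank1 x y)"
proof -
  have "(\<exists>f g. \<Phi> B = rank1 f g) \<longleftrightarrow>
      (\<forall>A \<in> \<Phi> ` bounded_operators. pseudo_spectrum \<epsilon> (adjoint_op A o\<^sub>L \<Phi> B) \<noteq> three_discs \<epsilon>)"
    unfolding surj by (rule rank1_iff_never_three_discs[OF dim eps image_bounded[OF assms]])
  also have "\<dots> \<longleftrightarrow>
      (\<forall>A \<in> bounded_operators. pseudo_spectrum \<epsilon> (adjoint_op A o\<^sub>L B) \<noteq> three_discs \<epsilon>)"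
    using pres[OF _ assms] by simp
  also have "\<dots> \<longleftrightarrow> (\<exists>x y. B = rank1 x y)"
    by (rule rank1_iff_never_three_discs[OF dim eps assms, symmetric])
  finally show ?thesis .
qed

lemma image_rank1: obtains f g where "\<Phi> (rank1 x y) = rank1 f g"
  using rank1_image_iff[OF bounded_operators_rank1] by blast

lemma rank1_preimage: obtains x y where "\<Phi> (rank1 x y) = rank1 f g"
proof -
  have "rank1 f g \<in> \<Phi> ` bounded_operators" using surj by blast
  then obtain A where A: "A \<in> bounded_operators" "\<Phi> A = rank1 f g" by (metis imageE)
  then obtain x y where "A = rank1 x y" using rank1_image_iff[OF A(1)] by blast
  then show ?thesis using A(2) that by blast
qed

text \<open>
  The products \<open>A\<^sup>* x y\<^sup>*\<close> and \<open>\<Phi>(A)\<^sup>* f g\<^sup>*\<close> are of rank at most one with equal pseudospectra, so their traces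
  agree.  This identity turns everything known about \<open>\<Phi>\<close> on operators of rank one into information about
  \<open>\<Phi> A\<close> for arbitrary \<open>A\<close>.
\<close>

lemma trace_preserved:
  assumes A: "A \<in> bounded_operators" and fg: "\<Phi> (rank1 x y) = rank1 f g"
  shows "cinner (blinfun_apply (\<Phi> A) g) f = cinner (blinfun_apply A y) x"
proof -
  have "pseudo_spectrum \<epsilon> (rank1 (blinfun_apply (adjoint_op (\<Phi> A)) f) g)
      = pseudo_spectrum \<epsilon> (rank1 (blinfun_apply (adjoint_op A) x) y)"
    using pres[OF A bounded_operators_rank1, of x y]
    by (simp add: fg compose_rank1 adjoint_op_bounded image_bounded A)
  from trace_determined_by_pseudo_spectrum[OF dim eps this] show ?thesis
    by (simp add: cinner_adjoint_op image_bounded A)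
qed

lemma rank1_trace_preserved:
  assumes "\<Phi> (rank1 x y) = rank1 f g" "\<Phi> (rank1 x' y') = rank1 f' g'"
  shows "cinner g g' * cinner f' f = cinner y y' * cinner x' x"
  using trace_preserved[OF bounded_operators_rank1 assms(1), of x' y']
  by (simp add: assms(2) op_apply cinner_simps flip: cinner_commute)

lemma image_nonzero_iff:
  assumes "\<Phi> (rank1 x y) = rank1 f g"
  shows "f \<noteq> 0 \<and> g \<noteq> 0 \<longleftrightarrow> x \<noteq> 0 \<and> y \<noteq> 0"
proof -
  have "cinner g g * cinner f f = 0 \<longleftrightarrow> cinner y y * cinner x x = 0"
    using rank1_trace_preserved[OF assms assms] by simp
  then show ?thesis by auto
qed

text \<open>
  The trace identity controls only the product of \<open>\<langle>f', f\<rangle>\<close> with \<open>\<langle>g, g'\<rangle>\<close>, and would also allow the two factors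
  to change roles, as a transposition does.  The order of the factors is detected by
  \<open>(x y\<^sup>*)\<^sup>* (x' y'\<^sup>*) = \<langle>x, x'\<rangle> y y'\<^sup>*\<close>, which for nonzero \<open>y\<close> and \<open>y'\<close> vanishes only if
  \<open>x\<close> and \<open>x'\<close> are orthogonal.
\<close>

lemma orthogonality_preserved:
  assumes fg: "\<Phi> (rank1 x y) = rank1 f g" "\<Phi> (rank1 x' y') = rank1 f' g'"
    and nz: "x \<noteq> 0" "y \<noteq> 0" "x' \<noteq> 0" "y' \<noteq> 0"
  shows "cinner f f' = 0 \<longleftrightarrow> cinner x x' = 0"
proof -
  have gnz: "g \<noteq> 0" "g' \<noteq> 0" using image_nonzero_iff[OF fg(1)] image_nonzero_iff[OF fg(2)] nz by auto
  have eq: "pseudo_spectrum \<epsilon> (rank1 (cinner f f' *\<^sub>C g) g')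
      = pseudo_spectrum \<epsilon> (rank1 (cinner x x' *\<^sub>C y) y')"
    using pres[of "rank1 x y" "rank1 x' y'"]
    by (simp add: fg adjoint_compose_rank1 bounded_operators_rank1)
  show ?thesis
  proof
    assume "cinner f f' = 0"
    then have "rank1 (cinner x x' *\<^sub>C y) y' = 0"
      using eq by (intro rank1_zero_if_pseudo_spectrum_zero[OF dim eps]) simp
    then show "cinner x x' = 0" using nz by (simp add: rank1_eq_0_iff)
  next
    assume "cinner x x' = 0"
    then have "rank1 (cinner f f' *\<^sub>C g) g' = 0"
      using eq by (intro rank1_zero_if_pseudo_spectrum_zero[OF dim eps]) simp
    then show "cinner f f' = 0" using gnz by (simp add: rank1_eq_0_iff)
  qed
qed

text \<open>
  By surjectivity, every \<open>h\<close> is the left factor of an image, so preservation of orthogonality shows that \<open>f\<close> and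
  \<open>f'\<close> are orthogonal to the same vectors.
\<close>

lemma left_factor_direction:
  assumes fg: "\<Phi> (rank1 x y) = rank1 f g" "\<Phi> (rank1 x y') = rank1 f' g'"
    and nz: "x \<noteq> 0" "y \<noteq> 0" "y' \<noteq> 0"
  shows "\<exists>c. f' = c *\<^sub>C f"
proof (rule proportional_if_orthogonal)
  fix h assume h: "cinner h f = 0" "h \<noteq> 0"
  obtain u v where uv: "\<Phi> (rank1 u v) = rank1 h h" using rank1_preimage by blast
  then have "u \<noteq> 0" "v \<noteq> 0" using image_nonzero_iff[OF uv] h(2) by auto
  then show "cinner h f' = 0"
    using orthogonality_preserved[OF uv fg(1)] orthogonality_preserved[OF uv fg(2)] nz h(1) by blast
qed

text \<open>
  The pairing \<open>\<langle>h, g\<rangle>\<close> occurs in the trace identity multiplied by a pairing of left factors.  A left factor \<open>k\<close>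
  orthogonal to neither \<open>f\<close> nor \<open>f'\<close> makes the latter nonzero, so \<open>g\<close> and \<open>g'\<close> are orthogonal to the same
  vectors.
\<close>

lemma right_factor_direction:
  assumes fg: "\<Phi> (rank1 x y) = rank1 f g" "\<Phi> (rank1 x' y) = rank1 f' g'"
    and nz: "x \<noteq> 0" "x' \<noteq> 0" "y \<noteq> 0"
  shows "\<exists>c. g' = c *\<^sub>C g"
proof (rule proportional_if_orthogonal)
  fix h assume h: "cinner h g = 0" "h \<noteq> 0"
  have "f \<noteq> 0" "f' \<noteq> 0" using image_nonzero_iff[OF fg(1)] image_nonzero_iff[OF fg(2)] nz by auto
  then obtain k where k: "cinner k f \<noteq> 0" "cinner k f' \<noteq> 0"
    by (rule exists_nonorthogonal_to_both)
  obtain u v where uv: "\<Phi> (rank1 u v) = rank1 k h" using rank1_preimage by blast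
  have uv0: "u \<noteq> 0" "v \<noteq> 0" using image_nonzero_iff[OF uv] h(2) k by auto
  have ux: "cinner u x \<noteq> 0" "cinner u x' \<noteq> 0"
    using orthogonality_preserved[OF uv fg(1)] orthogonality_preserved[OF uv fg(2)] uv0 nz k by auto
  have "cinner v y * cinner x u = 0"
    using rank1_trace_preserved[OF uv fg(1)] h(1) by simp
  then have "cinner v y = 0" using ux cinner_eq_0_commute[of x u] by simp
  then have "cinner h g' * cinner f' k = 0" using rank1_trace_preserved[OF uv fg(2)] by simp
  then show "cinner h g' = 0" using k cinner_eq_0_commute[of f' k] by simp
qed

text \<open>
  Since the directions of the two factors of \<open>\<Phi> (x y\<^sup>*)\<close> depend on \<open>x\<close> and on \<open>y\<close> alone, \<open>U\<close> and \<open>W\<close> can be read off from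
  \<open>\<Phi> (x e\<^sup>*)\<close> and \<open>\<Phi> (e y\<^sup>*)\<close> for a fixed unit vector \<open>e\<close>; the trace identity makes them isometries.  It
  remains to determine a scalar \<open>c\<close> in \<open>\<Phi> (x y\<^sup>*) = c U x (W y)\<^sup>*\<close>.  Comparison with \<open>x e\<^sup>*\<close>
  gives \<open>c = 1\<close> when \<open>y\<close> is not orthogonal to \<open>e\<close>, and comparison with \<open>x (y + e)\<^sup>*\<close> settles the other
  case.
\<close>

lemma image_rank1_unitary:
  obtains U W where "unitary_op U" "unitary_op W"
    "\<And>x y. x \<noteq> 0 \<Longrightarrow> y \<noteq> 0 \<Longrightarrow>
      \<Phi> (rank1 x y) = rank1 (blinfun_apply U x) (blinfun_apply W y)"
proof -
  obtain v :: 'a where "v \<noteq> 0" using exists_orthogonal_to_two[OF dim] by blast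
  define e where "e = (1 / complex_of_real (norm v)) *\<^sub>C v"
  have "norm e = 1" unfolding e_def using \<open>v \<noteq> 0\<close> by (rule norm_normalized)
  then have ee: "cinner e e = 1" and e0: "e \<noteq> 0" by (auto simp: cinner_self)
  obtain f' g' where fg': "\<Phi> (rank1 e e) = rank1 f' g'" by (rule image_rank1)
  then have "f' \<noteq> 0" and g': "g' \<noteq> 0" using image_nonzero_iff[OF fg'] e0 by auto
  define g where "g = (1 / complex_of_real (norm g')) *\<^sub>C g'"
  have "norm g = 1" unfolding g_def using g' by (rule norm_normalized)
  then have gg: "cinner g g = 1" by (simp add: cinner_self)
  have zero: "\<Phi> 0 = 0"
  proof -
    obtain x y :: 'a where xy: "\<Phi> (rank1 0 0) = rank1 x y" by (rule image_rank1)
    then have "x = 0 \<or> y = 0" using image_nonzero_iff[OF xy] by auto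
    then show ?thesis using xy by auto
  qed
  have "\<exists>u. \<Phi> (rank1 x e) = rank1 u g" for x
  proof (cases "x = 0")
    case True
    then have "\<Phi> (rank1 x e) = rank1 0 g" by (simp add: zero)
    then show ?thesis by blast
  next
    case False
    obtain f1 g1 where 1: "\<Phi> (rank1 x e) = rank1 f1 g1" by (rule image_rank1)
    obtain c where c: "g1 = c *\<^sub>C g'"
      using right_factor_direction[OF fg' 1 e0 False e0] by blast
    then have "g1 = cnj (cnj (c * norm g')) *\<^sub>C g" using g' by (simp add: g_def scaleC_scaleC)
    then have "\<Phi> (rank1 x e) = rank1 (cnj (c * norm g') *\<^sub>C f1) g"
      by (simp only: 1 rank1_scaleC)
    then show ?thesis by blast
  qed
  then obtain U where U: "\<And>x. \<Phi> (rank1 x e) = rank1 (U x) g" by metis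
  have U_iso: "cinner (U x) (U y) = cinner x y" for x y
    using rank1_trace_preserved[OF U[of y] U[of x]] gg ee by simp
  have U0: "U x \<noteq> 0" if "x \<noteq> 0" for x using U_iso[of x x] that by auto
  have "\<exists>w. \<Phi> (rank1 e y) = rank1 (U e) w" for y
  proof (cases "y = 0")
    case True
    then have "\<Phi> (rank1 e y) = rank1 (U e) 0" by (simp add: zero)
    then show ?thesis by blast
  next
    case False
    obtain f1 g1 where 1: "\<Phi> (rank1 e y) = rank1 f1 g1" by (rule image_rank1)
    obtain c where "f1 = c *\<^sub>C U e"
      using left_factor_direction[OF U[of e] 1 e0 e0 False] by blast
    then have "\<Phi> (rank1 e y) = rank1 (U e) (cnj c *\<^sub>C g1)"
      by (simp only: 1 rank1_scaleC)
    then show ?thesis by blast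
  qed
  then obtain W where W: "\<And>y. \<Phi> (rank1 e y) = rank1 (U e) (W y)" by metis
  have W_iso: "cinner (W x) (W y) = cinner x y" for x y
    using rank1_trace_preserved[OF W[of x] W[of y]] by (simp add: U_iso ee)
  have Wg: "cinner (W y) g = cinner y e" for y
    using rank1_trace_preserved[OF W[of y] U[of e]] by (simp add: U_iso ee)
  have U_total: "\<exists>c x. f = c *\<^sub>C U x" for f
  proof (cases "f = 0")
    case False
    obtain x y where xy: "\<Phi> (rank1 x y) = rank1 f f" by (rule rank1_preimage)
    then have "x \<noteq> 0" "y \<noteq> 0" using image_nonzero_iff[OF xy] False by auto
    then show ?thesis using left_factor_direction[OF U[of x] xy _ e0] by blast
  qed (use complex_vector.scale_zero_left in metis)
  have W_total: "\<exists>c x. f = c *\<^sub>C W x" for f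
  proof (cases "f = 0")
    case False
    obtain x y where xy: "\<Phi> (rank1 x y) = rank1 f f" by (rule rank1_preimage)
    then have "x \<noteq> 0" "y \<noteq> 0" using image_nonzero_iff[OF xy] False by auto
    then show ?thesis using right_factor_direction[OF W[of y] xy e0] by blast
  qed (use complex_vector.scale_zero_left in metis)
  have scaled: "\<exists>c. \<Phi> (rank1 x y) = rank1 (c *\<^sub>C U x) (W y)" if nz: "x \<noteq> 0" "y \<noteq> 0" for x y
  proof -
    obtain f1 g1 where 1: "\<Phi> (rank1 x y) = rank1 f1 g1" by (rule image_rank1)
    obtain c where c: "f1 = c *\<^sub>C U x" using left_factor_direction[OF U[of x] 1 nz(1) e0 nz(2)] by blast
    obtain d where d: "g1 = d *\<^sub>C W y" using right_factor_direction[OF W[of y] 1 e0 nz] by blast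
    have "\<Phi> (rank1 x y) = rank1 ((cnj d * c) *\<^sub>C U x) (W y)"
      using rank1_scaleC[of "cnj d" "c *\<^sub>C U x" "W y"] by (simp add: 1 c d scaleC_scaleC)
    then show ?thesis by blast
  qed
  have not_orth: "\<Phi> (rank1 x y) = rank1 (U x) (W y)"
    if nz: "x \<noteq> 0" "y \<noteq> 0" and ye: "cinner y e \<noteq> 0" for x y
  proof -
    obtain c where c: "\<Phi> (rank1 x y) = rank1 (c *\<^sub>C U x) (W y)" using scaled[OF nz] by blast
    have "cinner y e * (c * cinner x x) = cinner y e * cinner x x"
      using rank1_trace_preserved[OF c U[of x]] by (simp add: cinner_simps U_iso Wg)
    then have "c = 1" using ye nz(1) by simp
    then show ?thesis using c by (simp add: scaleC_one)
  qed
  have all: "\<Phi> (rank1 x y) = rank1 (U x) (W y)" if nz: "x \<noteq> 0" "y \<noteq> 0" for x y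
  proof (cases "cinner y e = 0")
    case True
    obtain c where c: "\<Phi> (rank1 x y) = rank1 (c *\<^sub>C U x) (W y)" using scaled[OF nz] by blast
    have ye: "cinner (y + e) e = 1" by (simp add: cinner_simps True ee)
    then have "y + e \<noteq> 0" by auto
    then have "\<Phi> (rank1 x (y + e)) = rank1 (U x) (W (y + e))"
      using ye by (intro not_orth nz(1)) auto
    from rank1_trace_preserved[OF c this]
    have "cinner y y * (c * cinner x x) = cinner y y * cinner x x"
      by (simp add: cinner_simps U_iso W_iso True)
    then have "c = 1" using nz by simp
    then show ?thesis using c by (simp add: scaleC_one)
  qed (rule not_orth[OF nz])
  obtain UT where "unitary_op UT" "\<And>x. blinfun_apply UT x = U x"
    using isometry_with_total_range_is_unitary[OF U_iso U_total] by blast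
  moreover obtain WT where "unitary_op WT" "\<And>x. blinfun_apply WT x = W x"
    using isometry_with_total_range_is_unitary[OF W_iso W_total] by blast
  ultimately show ?thesis using that all by metis
qed

text \<open>
  Writing \<open>y = W\<^sup>* v\<close>, the trace identity with \<open>x y\<^sup>*\<close> gives
  \<open>\<langle>\<Phi>(A) v, U x\<rangle> = \<langle>A y, x\<rangle> = \<langle>U A W\<^sup>* v, U x\<rangle>\<close> for all \<open>x\<close>.
\<close>

lemma image_unitary:
  obtains U V where "unitary_op U" "unitary_op V"
    "\<And>A. A \<in> bounded_operators \<Longrightarrow> \<Phi> A = U o\<^sub>L A o\<^sub>L V"
proof -
  obtain U W where U: "unitary_op U" and W: "unitary_op W"
    and UW: "\<And>x y. x \<noteq> 0 \<Longrightarrow> y \<noteq> 0 \<Longrightarrow>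
      \<Phi> (rank1 x y) = rank1 (blinfun_apply U x) (blinfun_apply W y)"
    using image_rank1_unitary by blast
  have Ub: "U \<in> bounded_operators" using U by (simp add: unitary_op_def)
  have U_inv: "blinfun_apply U (blinfun_apply (adjoint_op U) v) = v"
    "blinfun_apply (adjoint_op U) (blinfun_apply U v) = v" for v
    using U blinfun_apply_blinfun_compose[of U "adjoint_op U" v]
      blinfun_apply_blinfun_compose[of "adjoint_op U" U v] by (simp_all add: unitary_op_def)
  have W_inv: "blinfun_apply W (blinfun_apply (adjoint_op W) v) = v" for v
    using W blinfun_apply_blinfun_compose[of W "adjoint_op W" v] by (simp add: unitary_op_def)
  have "\<Phi> A = U o\<^sub>L A o\<^sub>L adjoint_op W" if A: "A \<in> bounded_operators" for A
  proof (rule blinfun_eqI)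
    fix v
    define y where "y = blinfun_apply (adjoint_op W) v"
    have v: "v = blinfun_apply W y" by (simp add: y_def W_inv)
    show "blinfun_apply (\<Phi> A) v = blinfun_apply (U o\<^sub>L A o\<^sub>L adjoint_op W) v"
    proof (cases "y = 0")
      case True
      then show ?thesis using v by (simp flip: y_def)
    next
      case False
      have "cinner (blinfun_apply (\<Phi> A) v) (blinfun_apply U x)
          = cinner (blinfun_apply U (blinfun_apply A y)) (blinfun_apply U x)" for x
      proof (cases "x = 0")
        case nx: False
        have "cinner (blinfun_apply (\<Phi> A) v) (blinfun_apply U x) = cinner (blinfun_apply A y) x"
          unfolding v by (rule trace_preserved[OF A UW[OF nx False]])
        then show ?thesis by (simp add: U_inv flip: cinner_adjoint_op_left[OF Ub])
      qed simp
      then have "cinner z (blinfun_apply (\<Phi> A) v)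
          = cinner z (blinfun_apply U (blinfun_apply A y))" for z
        by (metis U_inv(1) cinner_commute)
      then show ?thesis by (simp flip: y_def) (rule cinner_ext)
    qed
  qed
  then show ?thesis using that U unitary_op_adjoint[OF W] by blast
qed

end

theorem corollary5p4:
  fixes \<Phi> :: "('a::complex_hilbert_space \<Rightarrow>\<^sub>L 'a) \<Rightarrow> ('a \<Rightarrow>\<^sub>L 'a)"
    and \<epsilon> :: real
  assumes dim_ge_3: "\<exists>S :: 'a set. card S = 3 \<and> complex_vector.independent S"
    and eps_pos: "\<epsilon> > 0"
    and surjective: "\<Phi> ` bounded_operators = bounded_operators"
    and preserves: "\<And>A B. A \<in> bounded_operators \<Longrightarrow> B \<in> bounded_operators \<Longrightarrow>
      pseudo_spectrum \<epsilon> (adjoint_op (\<Phi> A) o\<^sub>L \<Phi> B) = pseudo_spectrum \<epsilon> (adjoint_op A o\<^sub>L B)"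
  shows "\<exists>\<alpha> U V. cmod \<alpha> = 1 \<and> unitary_op U \<and> unitary_op V \<and>
    (\<forall>A \<in> bounded_operators. \<Phi> A = scaleC_op \<alpha> (U o\<^sub>L A o\<^sub>L V))"
proof -
  interpret pseudo_spectrum_preserver \<Phi> \<epsilon>
    by unfold_locales (fact dim_ge_3 eps_pos surjective preserves)+
  obtain U V where "unitary_op U" "unitary_op V"
    "\<And>A. A \<in> bounded_operators \<Longrightarrow> \<Phi> A = U o\<^sub>L A o\<^sub>L V"
    using image_unitary by blast
  moreover have "scaleC_op 1 B = B" for B :: "'a \<Rightarrow>\<^sub>L 'a"
    by (rule blinfun_eqI) (simp add: op_apply scaleC_one)
  ultimately show ?thesis by (intro exI[of _ 1] exI[of _ U] exI[of _ V]) simp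
qed

end
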